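(* Let $W_1,W_2$ be irreducible $\hat{\mathfrak{g}}[\sigma]$-modules in the category $\mathcal{R}$ and let $U_1,U_2$ be irreducible $\hat{\mathfrak{g}}[\sigma]$-modules in the category $\mathcal{E}$. Then the tensor product $\hat{\mathfrak{g}}[\sigma]$-modules $W_1\otimes U_1$ and $W_2\otimes U_2$ are isomorphic if and only if $W_1$ and $U_1$ are isomorphic to $W_2$ and $U_2$, respectively.
   Context: Let $\mathfrak{g}$ be a finite-dimensional simple Lie algebra over $\mathbb{C}$ with the nondegenerate symmetric invariant bilinear form $\langle\cdot,\cdot\rangle$ normalized so that the squared length of the longest roots is $2$. Let $\sigma$ be an automorphism of $\mathfrak{g}$ of order $N$, $\varepsilon=\exp(2\pi \sqrt{-1}/N)$, and $\mathfrak{g}_i=\{a\in\mathfrak{g}\mid \sigma(a)=\varepsilon^i a\}$ for $0\le i\le N-1$, so $\mathfrak{g}=\bigoplus_{i=0}^{N-1}\mathfrak{g}_i$. The twisted affine Lie algebra is $\hat{\mathfrak{g}}[\sigma]=\bigoplus_{i=0}^{N-1}\mathfrak{g}_i\otimes t^{i/N}\mathbb{C}[t,t^{-1}]\oplus\mathbb{C}\mathbf{k}$ with $\mathbf{k}$ a nonzero central element and $[a\otimes t^{m+i/N},b\otimes t^{n+j/N}]=[a,b]\otimes t^{m+n+(i+j)/N}+(m+\tfrac{i}{N})\langle a,b\rangle\delta_{m+i/N,\,-n-j/N}\mathbf{k}$ for $a\in\mathfrak{g}_i$, $b\in\mathfrak{g}_j$, $m,n\in\mathbb{Z}$. For $a\in\mathfrak{g}_i$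 put $a(x)=\sum_{n\in\mathbb{Z}}(a\otimes t^{n+i/N})x^{-n-i/N-1}$, extended linearly to all $a\in\mathfrak{g}$. Category $\mathcal{R}$ (restricted modules): the $\hat{\mathfrak{g}}[\sigma]$-modules $W$ such that for all $a\in\mathfrak{g}$ and $w\in W$, $a(x)w\in W((x^{1/N}))$, the space of lower truncated formal Laurent series in $x^{1/N}$ with coefficients in $W$. Category $\mathcal{E}$: the $\hat{\mathfrak{g}}[\sigma]$-modules $U$ for which there exists a nonzero polynomial $p(x)\in\mathbb{C}[x]$, depending on $U$, such that $p(x)a(x)u=0$ for all $a\in\mathfrak{g}$, $u\in U$. *)

theory Defs
  imports Complex_Main "HOL-Library.Product_Plus" "HOL-Library.Poly_Mapping"
    "HOL-Computational_Algebra.Polynomial"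
begin

section \<open>Complex vector spaces\<close>

class complex_vector = ab_group_add +
  fixes scaleC :: "complex \<Rightarrow> 'a \<Rightarrow> 'a"  (infixr "*\<^sub>c" 75)
  assumes scaleC_add_right: "c *\<^sub>c (x + y) = c *\<^sub>c x + c *\<^sub>c y"
    and scaleC_add_left: "(c + d) *\<^sub>c x = c *\<^sub>c x + d *\<^sub>c x"
    and scaleC_scaleC: "c *\<^sub>c d *\<^sub>c x = (c * d) *\<^sub>c x"
    and scaleC_one: "1 *\<^sub>c x = x"

global_interpretation complex_vector:
  vector_space "scaleC :: complex \<Rightarrow> 'a \<Rightarrow> 'a :: complex_vector"
  by unfold_locales (rule scaleC_add_right scaleC_add_left scaleC_scaleC scaleC_one)+

abbreviation clinear :: "('a::complex_vector \<Rightarrow> 'b::complex_vector) \<Rightarrow> bool" where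
  "clinear \<equiv> Vector_Spaces.linear scaleC scaleC"

lemma clinear_iff:
  "clinear f \<longleftrightarrow> (\<forall>x y. f (x + y) = f x + f y) \<and> (\<forall>c x. f (c *\<^sub>c x) = c *\<^sub>c f x)"
  by (simp add: Vector_Spaces.linear_iff complex_vector.vector_space_axioms)

definition cbilinear ::
    "('a::complex_vector \<Rightarrow> 'b::complex_vector \<Rightarrow> 'c::complex_vector) \<Rightarrow> bool" where
  "cbilinear B \<longleftrightarrow> (\<forall>x. clinear (B x)) \<and> (\<forall>y. clinear (\<lambda>x. B x y))"

instantiation complex :: complex_vector
begin
definition scaleC_complex :: "complex \<Rightarrow> complex \<Rightarrow> complex" where
  "scaleC_complex = (*)"
instance by standard (simp_all add: scaleC_complex_def algebra_simps)
end

instantiation prod :: (complex_vector, complex_vector) complex_vector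
begin
definition scaleC_prod :: "complex \<Rightarrow> 'a \<times> 'b \<Rightarrow> 'a \<times> 'b" where
  "c *\<^sub>c p = (c *\<^sub>c fst p, c *\<^sub>c snd p)"
instance
  by standard (simp_all add: scaleC_prod_def prod_eq_iff scaleC_add_right scaleC_add_left
      scaleC_scaleC scaleC_one)
end

instantiation poly_mapping :: (type, complex_vector) complex_vector
begin
lift_definition scaleC_poly_mapping :: "complex \<Rightarrow> ('a \<Rightarrow>\<^sub>0 'b) \<Rightarrow> 'a \<Rightarrow>\<^sub>0 'b" is
  "\<lambda>c f k. c *\<^sub>c f k"
proof -
  fix c :: complex and f :: "'a \<Rightarrow> 'b"
  assume "finite {k. f k \<noteq> 0}"
  then show "finite {k. c *\<^sub>c f k \<noteq> 0}"
    by (rule rev_finite_subset) auto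
qed
instance
  by standard (simp_all add: poly_mapping_eq_iff fun_eq_iff scaleC_poly_mapping.rep_eq lookup_add
      scaleC_add_right scaleC_add_left scaleC_scaleC scaleC_one)
end


section \<open>Tensor products\<close>

definition tensor_relators ::
    "(('a::complex_vector \<times> 'b::complex_vector) \<Rightarrow>\<^sub>0 complex) set" where
  "tensor_relators =
     {Poly_Mapping.single (w + w', u) 1 - Poly_Mapping.single (w, u) 1
        - Poly_Mapping.single (w', u) 1 | w w' u. True}
   \<union> {Poly_Mapping.single (w, u + u') 1 - Poly_Mapping.single (w, u) 1
        - Poly_Mapping.single (w, u') 1 | w u u'. True}
   \<union> {Poly_Mapping.single (c *\<^sub>c w, u) 1 - c *\<^sub>c Poly_Mapping.single (w, u) 1 | c w u. True}
   \<union> {Poly_Mapping.single (w, c *\<^sub>c u) 1 - c *\<^sub>c Poly_Mapping.single (w, u) 1 | c w u. True}"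

definition tensor_rel ::
    "(('a::complex_vector \<times> 'b::complex_vector) \<Rightarrow>\<^sub>0 complex) \<Rightarrow>
     (('a \<times> 'b) \<Rightarrow>\<^sub>0 complex) \<Rightarrow> bool" where
  "tensor_rel p q \<longleftrightarrow> p - q \<in> complex_vector.span tensor_relators"

lemma equivp_tensor_rel: 
  "equivp (tensor_rel :: (('a::complex_vector \<times> 'b::complex_vector) \<Rightarrow>\<^sub>0 complex) \<Rightarrow> _)"
  (is "equivp ?R")
proof (rule equivpI)
  show "reflp ?R"
    by (rule reflpI) (simp add: tensor_rel_def complex_vector.span_zero)
  show "symp ?R"
  proof (rule sympI)
    fix p q :: "('a \<times> 'b) \<Rightarrow>\<^sub>0 complex"
    assume "tensor_rel p q"
    then show "tensor_rel q p"
      unfolding tensor_rel_def using complex_vector.span_neg[of "p - q"] by simp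
  qed
  show "transp ?R"
  proof (rule transpI)
    fix p q r :: "('a \<times> 'b) \<Rightarrow>\<^sub>0 complex"
    assume "tensor_rel p q" "tensor_rel q r"
    then show "tensor_rel p r"
      unfolding tensor_rel_def using complex_vector.span_add[of "p - q" _ "q - r"] by simp
  qed
qed

quotient_type (overloaded) ('a, 'b) tensor =
  "('a::complex_vector \<times> 'b::complex_vector) \<Rightarrow>\<^sub>0 complex" / tensor_rel
  by (rule equivp_tensor_rel)

instantiation tensor :: (complex_vector, complex_vector) complex_vector
begin

lift_definition zero_tensor :: "('a, 'b) tensor" is 0 .

lift_definition plus_tensor :: "('a, 'b) tensor \<Rightarrow> ('a, 'b) tensor \<Rightarrow> ('a, 'b) tensor" is "(+)"
proof -
  fix p p' q q' :: "('a \<times> 'b) \<Rightarrow>\<^sub>0 complex"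
  assume "tensor_rel p p'" "tensor_rel q q'"
  then show "tensor_rel (p + q) (p' + q')"
    unfolding tensor_rel_def
    using complex_vector.span_add[of "p - p'" _ "q - q'"] by (simp add: algebra_simps)
qed

lift_definition minus_tensor :: "('a, 'b) tensor \<Rightarrow> ('a, 'b) tensor \<Rightarrow> ('a, 'b) tensor" is "(-)"
proof -
  fix p p' q q' :: "('a \<times> 'b) \<Rightarrow>\<^sub>0 complex"
  assume "tensor_rel p p'" "tensor_rel q q'"
  then show "tensor_rel (p - q) (p' - q')"
    unfolding tensor_rel_def
    using complex_vector.span_diff[of "p - p'" _ "q - q'"] by (simp add: algebra_simps)
qed

lift_definition uminus_tensor :: "('a, 'b) tensor \<Rightarrow> ('a, 'b) tensor" is uminus
proof -
  fix p p' :: "('a \<times> 'b) \<Rightarrow>\<^sub>0 complex"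
  assume "tensor_rel p p'"
  then show "tensor_rel (- p) (- p')"
    unfolding tensor_rel_def
    using complex_vector.span_neg[of "p - p'"] by (simp add: algebra_simps)
qed

lift_definition scaleC_tensor :: "complex \<Rightarrow> ('a, 'b) tensor \<Rightarrow> ('a, 'b) tensor" is scaleC
proof -
  fix c and p p' :: "('a \<times> 'b) \<Rightarrow>\<^sub>0 complex"
  assume "tensor_rel p p'"
  then show "tensor_rel (c *\<^sub>c p) (c *\<^sub>c p')"
    unfolding tensor_rel_def
    using complex_vector.span_scale[of "p - p'" _ c]
    by (simp add: complex_vector.scale_right_diff_distrib)
qed

instance
proof
  fix a b c :: "('a, 'b) tensor" and r s :: complex
  have r: "tensor_rel p q" if "p = q" for p q :: "('a \<times> 'b) \<Rightarrow>\<^sub>0 complex"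
    using that equivp_reflp[OF equivp_tensor_rel] by auto
  show "a + b + c = a + (b + c)" by transfer (rule r, simp add: algebra_simps)
  show "a + b = b + a" by transfer (rule r, simp add: algebra_simps)
  show "0 + a = a" by transfer (rule r, simp)
  show "- a + a = 0" by transfer (rule r, simp)
  show "a - b = a + - b" by transfer (rule r, simp)
  show "r *\<^sub>c (a + b) = r *\<^sub>c a + r *\<^sub>c b" by transfer (rule r, simp add: scaleC_add_right)
  show "(r + s) *\<^sub>c a = r *\<^sub>c a + s *\<^sub>c a" by transfer (rule r, simp add: scaleC_add_left)
  show "r *\<^sub>c s *\<^sub>c a = (r * s) *\<^sub>c a" by transfer (rule r, simp add: scaleC_scaleC)
  show "1 *\<^sub>c a = a" by transfer (rule r, simp add: scaleC_one)
qed

end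

lift_definition pure_tensor ::
    "'a::complex_vector \<Rightarrow> 'b::complex_vector \<Rightarrow> ('a, 'b) tensor"  (infixr "\<otimes>\<^sub>c" 76) is
  "\<lambda>w u. Poly_Mapping.single (w, u) 1" .

definition free_extension ::
    "('a::complex_vector \<Rightarrow> 'b::complex_vector \<Rightarrow> 'c::complex_vector) \<Rightarrow>
     (('a \<times> 'b) \<Rightarrow>\<^sub>0 complex) \<Rightarrow> 'c" where
  "free_extension B p =
     (\<Sum>(w, u) \<in> Poly_Mapping.keys p. Poly_Mapping.lookup p (w, u) *\<^sub>c B w u)"

lemma free_extension_superset:
  assumes "finite S" "Poly_Mapping.keys p \<subseteq> S"
  shows "free_extension B p = (\<Sum>(w, u) \<in> S. Poly_Mapping.lookup p (w, u) *\<^sub>c B w u)"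
  unfolding free_extension_def
  by (rule sum.mono_neutral_left[OF assms]) (auto simp: in_keys_iff)

lemma free_extension_single [simp]:
  "free_extension B (Poly_Mapping.single (w, u) c) = c *\<^sub>c B w u"
  by (subst free_extension_superset[of "{(w, u)}"]) auto

lemma clinear_free_extension: "clinear (free_extension B)"
  unfolding clinear_iff
proof (intro conjI allI)
  fix p q :: "('a \<times> 'b) \<Rightarrow>\<^sub>0 complex" and c
  let ?S = "Poly_Mapping.keys p \<union> Poly_Mapping.keys q"
  have "Poly_Mapping.keys (p + q) \<subseteq> ?S" by (rule Poly_Mapping.keys_add)
  then show "free_extension B (p + q) = free_extension B p + free_extension B q"
    by (simp add: free_extension_superset[of ?S] lookup_add scaleC_add_left
        case_prod_unfold sum.distrib)
  have "Poly_Mapping.keys (c *\<^sub>c p) \<subseteq> Poly_Mapping.keys p"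
    by (auto simp: in_keys_iff scaleC_poly_mapping.rep_eq)
  then show "free_extension B (c *\<^sub>c p) = c *\<^sub>c free_extension B p"
    by (simp add: free_extension_superset[of "Poly_Mapping.keys p"] scaleC_poly_mapping.rep_eq
        scaleC_complex_def case_prod_unfold complex_vector.scale_sum_right scaleC_scaleC)
qed

lemma free_extension_relators:
  assumes "cbilinear B" "p \<in> complex_vector.span tensor_relators"
  shows "free_extension B p = 0"
proof -
  interpret L: Vector_Spaces.linear scaleC scaleC "free_extension B"
    by (rule clinear_free_extension)
  have "complex_vector.span tensor_relators \<subseteq> {p. free_extension B p = 0}"
    using assms(1)
    by (intro complex_vector.span_minimal L.subspace_kernel)
      (auto simp: tensor_relators_def cbilinear_def clinear_iff L.diff L.scale scaleC_one)
  then show ?thesis using assms(2) by blast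
qed

text \<open>The linear map induced on the tensor product by a bilinear map (zero if the given
  map is not bilinear).\<close>

lift_definition tensor_lift ::
    "('a::complex_vector \<Rightarrow> 'b::complex_vector \<Rightarrow> 'c::complex_vector) \<Rightarrow> ('a, 'b) tensor \<Rightarrow> 'c" is
  "\<lambda>B p. if cbilinear B then free_extension B p else 0"
proof -
  fix B :: "'a \<Rightarrow> 'b \<Rightarrow> 'c" and p q :: "('a \<times> 'b) \<Rightarrow>\<^sub>0 complex"
  interpret L: Vector_Spaces.linear scaleC scaleC "free_extension B"
    by (rule clinear_free_extension)
  assume "tensor_rel p q"
  then show "(if cbilinear B then free_extension B p else 0)
           = (if cbilinear B then free_extension B q else 0)"
    using free_extension_relators[of B "p - q"] by (auto simp: tensor_rel_def L.diff)
qed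

lemma clinear_tensor_lift: "clinear (tensor_lift B)"
  using clinear_free_extension[of B] unfolding clinear_iff by transfer auto

lemma tensor_lift_pure: "cbilinear B \<Longrightarrow> tensor_lift B (w \<otimes>\<^sub>c u) = B w u"
  by transfer (simp add: scaleC_one)

lemma cbilinear_pure_tensor: "cbilinear (\<otimes>\<^sub>c)"
  unfolding cbilinear_def clinear_iff
proof (intro conjI allI)
  have base: "tensor_rel p q" if "p - q \<in> tensor_relators"
    for p q :: "('a \<times> 'b) \<Rightarrow>\<^sub>0 complex"
    using that unfolding tensor_rel_def by (rule complex_vector.span_base)
  fix w w' :: 'a and u u' :: 'b and c
  show "w \<otimes>\<^sub>c (u + u') = w \<otimes>\<^sub>c u + w \<otimes>\<^sub>c u'"
    by transfer (rule base, unfold tensor_relators_def diff_diff_eq[symmetric], blast)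
  show "w \<otimes>\<^sub>c (c *\<^sub>c u) = c *\<^sub>c (w \<otimes>\<^sub>c u)"
    by transfer (rule base, unfold tensor_relators_def, blast)
  show "(w + w') \<otimes>\<^sub>c u = w \<otimes>\<^sub>c u + w' \<otimes>\<^sub>c u"
    by transfer (rule base, unfold tensor_relators_def diff_diff_eq[symmetric], blast)
  show "(c *\<^sub>c w) \<otimes>\<^sub>c u = c *\<^sub>c (w \<otimes>\<^sub>c u)"
    by transfer (rule base, unfold tensor_relators_def, blast)
qed

lemma span_pure_tensors:
  "complex_vector.span (range (\<lambda>(w, u). w \<otimes>\<^sub>c u)) =
     (UNIV :: ('a::complex_vector, 'b::complex_vector) tensor set)"
proof -
  let ?S = "complex_vector.span (range (\<lambda>(w, u). w \<otimes>\<^sub>c u)) :: ('a, 'b) tensor set"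
  have "abs_tensor p \<in> ?S" for p :: "('a \<times> 'b) \<Rightarrow>\<^sub>0 complex"
  proof (induction p rule: update_induct)
    case const
    then show ?case by (simp add: zero_tensor_def[symmetric] complex_vector.span_zero)
  next
    case (update p k c)
    obtain w u where k: "k = (w, u)" by (cases k)
    have "Poly_Mapping.update k c p = p + c *\<^sub>c Poly_Mapping.single k 1"
      using update(1)
      by (intro poly_mapping_eqI)
        (auto simp: lookup_update lookup_add scaleC_poly_mapping.rep_eq scaleC_complex_def
          lookup_single in_keys_iff when_def)
    then have "abs_tensor (Poly_Mapping.update k c p) = abs_tensor p + c *\<^sub>c (w \<otimes>\<^sub>c u)"
      by (simp add: k pure_tensor.abs_eq scaleC_tensor.abs_eq plus_tensor.abs_eq)
    moreover have "w \<otimes>\<^sub>c u \<in> ?S"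
      by (rule complex_vector.span_base) (auto intro: image_eqI[of _ _ "(w, u)"])
    ultimately show ?case
      using update(3) by (simp add: complex_vector.span_scale complex_vector.span_add)
  qed
  then show ?thesis by (metis Quotient3_abs_rep Quotient3_tensor UNIV_eq_I)
qed


section \<open>Lie algebras\<close>

locale lie_algebra =
  fixes br :: "'g::complex_vector \<Rightarrow> 'g \<Rightarrow> 'g"
  assumes bilinear: "cbilinear br"
    and alternating: "br x x = 0"
    and jacobi: "br x (br y z) + br y (br z x) + br z (br x y) = 0"

definition lie_ideal :: "('g::complex_vector \<Rightarrow> 'g \<Rightarrow> 'g) \<Rightarrow> 'g set \<Rightarrow> bool" where
  "lie_ideal br I \<longleftrightarrow> complex_vector.subspace I \<and> (\<forall>x. \<forall>y\<in>I. br x y \<in> I)"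

locale simple_lie_algebra = lie_algebra br for br :: "'g::complex_vector \<Rightarrow> 'g \<Rightarrow> 'g" +
  assumes non_abelian: "\<exists>x y. br x y \<noteq> 0"
    and ideals_trivial: "lie_ideal br I \<Longrightarrow> I = {0} \<or> I = UNIV"

locale invariant_form = lie_algebra br for br :: "'g::complex_vector \<Rightarrow> 'g \<Rightarrow> 'g" +
  fixes form :: "'g \<Rightarrow> 'g \<Rightarrow> complex"
  assumes form_bilinear: "cbilinear form"
    and form_symmetric: "form x y = form y x"
    and form_invariant: "form (br x y) z = form x (br y z)"
    and form_nondegenerate: "(\<And>y. form x y = 0) \<Longrightarrow> x = 0"

primrec lower_central_series ::
    "('g::complex_vector \<Rightarrow> 'g \<Rightarrow> 'g) \<Rightarrow> 'g set \<Rightarrow> nat \<Rightarrow> 'g set" where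
  "lower_central_series br H 0 = H"
| "lower_central_series br H (Suc n) =
     complex_vector.span {br x y | x y. x \<in> H \<and> y \<in> lower_central_series br H n}"

definition cartan_subalgebra :: "('g::complex_vector \<Rightarrow> 'g \<Rightarrow> 'g) \<Rightarrow> 'g set \<Rightarrow> bool" where
  "cartan_subalgebra br H \<longleftrightarrow>
     complex_vector.subspace H \<and> (\<forall>x\<in>H. \<forall>y\<in>H. br x y \<in> H) \<and>
     (\<exists>n. lower_central_series br H n = {0}) \<and>
     {x. \<forall>h\<in>H. br x h \<in> H} = H"

text \<open>Only the values of \<open>\<alpha>\<close> on \<open>H\<close> matter; its linearity on \<open>H\<close> is automatic.\<close>

definition is_root ::
    "('g::complex_vector \<Rightarrow> 'g \<Rightarrow> 'g) \<Rightarrow> 'g set \<Rightarrow> ('g \<Rightarrow> complex) \<Rightarrow> bool" where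
  "is_root br H \<alpha> \<longleftrightarrow>
     (\<exists>h\<in>H. \<alpha> h \<noteq> 0) \<and> (\<exists>x. x \<noteq> 0 \<and> (\<forall>h\<in>H. br h x = \<alpha> h *\<^sub>c x))"

text \<open>The form identifies a root \<open>\<alpha>\<close> with the element \<open>t\<close> of \<open>H\<close> representing it; the squared
  length of \<open>\<alpha>\<close> is \<open>form t t\<close>.\<close>

definition root_square_lengths ::
    "('g::complex_vector \<Rightarrow> 'g \<Rightarrow> 'g) \<Rightarrow> ('g \<Rightarrow> 'g \<Rightarrow> complex) \<Rightarrow> 'g set \<Rightarrow> complex set" where
  "root_square_lengths br form H =
     {form t t | t \<alpha>. is_root br H \<alpha> \<and> t \<in> H \<and> (\<forall>h\<in>H. form t h = \<alpha> h)}"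

text \<open>All Cartan subalgebras are conjugate under automorphisms preserving the form, so the
  choice of \<open>H\<close> is immaterial.\<close>

definition long_roots_normalized ::
    "('g::complex_vector \<Rightarrow> 'g \<Rightarrow> 'g) \<Rightarrow> ('g \<Rightarrow> 'g \<Rightarrow> complex) \<Rightarrow> bool" where
  "long_roots_normalized br form \<longleftrightarrow>
     (\<exists>H. cartan_subalgebra br H \<and>
          (\<forall>z\<in>root_square_lengths br form H. z \<in> \<real> \<and> Re z \<le> 2) \<and>
          2 \<in> root_square_lengths br form H)"

definition lie_automorphism ::
    "('g::complex_vector \<Rightarrow> 'g \<Rightarrow> 'g) \<Rightarrow> ('g \<Rightarrow> 'g) \<Rightarrow> bool" where
  "lie_automorphism br \<sigma> \<longleftrightarrow>
     clinear \<sigma> \<and> bij \<sigma> \<and> (\<forall>x y. \<sigma> (br x y) = br (\<sigma> x) (\<sigma> y))"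

definition has_order :: "('g \<Rightarrow> 'g) \<Rightarrow> nat \<Rightarrow> bool" where
  "has_order \<sigma> N \<longleftrightarrow> 0 < N \<and> \<sigma> ^^ N = id \<and> (\<forall>k. 0 < k \<and> k < N \<longrightarrow> \<sigma> ^^ k \<noteq> id)"


section \<open>Lie modules\<close>

text \<open>A Lie algebra may be given on a subspace \<open>L\<close> of the type \<^typ>\<open>'l\<close>; a module structure
  \<open>\<rho>\<close> is only constrained on \<open>L\<close>.\<close>

locale lie_module =
  fixes L :: "'l::complex_vector set"
    and br :: "'l \<Rightarrow> 'l \<Rightarrow> 'l"
    and \<rho> :: "'l \<Rightarrow> 'w::complex_vector \<Rightarrow> 'w"
  assumes act_linear: "x \<in> L \<Longrightarrow> clinear (\<rho> x)"
    and act_add: "x \<in> L \<Longrightarrow> y \<in> L \<Longrightarrow> \<rho> (x + y) w = \<rho> x w + \<rho> y w"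
    and act_scale: "x \<in> L \<Longrightarrow> \<rho> (c *\<^sub>c x) w = c *\<^sub>c \<rho> x w"
    and act_bracket: "x \<in> L \<Longrightarrow> y \<in> L \<Longrightarrow> \<rho> (br x y) w = \<rho> x (\<rho> y w) - \<rho> y (\<rho> x w)"

definition irreducible_module ::
    "'l set \<Rightarrow> ('l \<Rightarrow> 'w::complex_vector \<Rightarrow> 'w) \<Rightarrow> bool" where
  "irreducible_module L \<rho> \<longleftrightarrow>
     (\<exists>w::'w. w \<noteq> 0) \<and>
     (\<forall>S. complex_vector.subspace S \<and> (\<forall>x\<in>L. \<forall>w\<in>S. \<rho> x w \<in> S) \<longrightarrow> S = {0} \<or> S = UNIV)"

definition isomorphic_modules ::
    "'l set \<Rightarrow> ('l \<Rightarrow> 'w::complex_vector \<Rightarrow> 'w) \<Rightarrow> ('l \<Rightarrow> 'v::complex_vector \<Rightarrow> 'v) \<Rightarrow> bool" where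
  "isomorphic_modules L \<rho> \<tau> \<longleftrightarrow>
     (\<exists>\<phi>. clinear \<phi> \<and> bij \<phi> \<and> (\<forall>x\<in>L. \<forall>w. \<phi> (\<rho> x w) = \<tau> x (\<phi> w)))"

definition tensor_module ::
    "('l \<Rightarrow> 'w::complex_vector \<Rightarrow> 'w) \<Rightarrow> ('l \<Rightarrow> 'u::complex_vector \<Rightarrow> 'u) \<Rightarrow>
     'l \<Rightarrow> ('w, 'u) tensor \<Rightarrow> ('w, 'u) tensor" where
  "tensor_module \<rho> \<tau> x = tensor_lift (\<lambda>w u. \<rho> x w \<otimes>\<^sub>c u + w \<otimes>\<^sub>c \<tau> x u)"

lemma tensor_module_pure:
  fixes \<rho> :: "'l \<Rightarrow> 'w::complex_vector \<Rightarrow> 'w" and \<tau> :: "'l \<Rightarrow> 'u::complex_vector \<Rightarrow> 'u"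
  assumes "clinear (\<rho> x)" "clinear (\<tau> x)"
  shows "tensor_module \<rho> \<tau> x (w \<otimes>\<^sub>c u) = \<rho> x w \<otimes>\<^sub>c u + w \<otimes>\<^sub>c \<tau> x u"
  unfolding tensor_module_def
  by (rule tensor_lift_pure)
    (use assms cbilinear_pure_tensor[where 'a = 'w and 'b = 'u] in
      \<open>simp add: cbilinear_def clinear_iff scaleC_add_right add_ac\<close>)


section \<open>Twisted affine Lie algebras\<close>

definition eigenspace :: "('g::complex_vector \<Rightarrow> 'g) \<Rightarrow> nat \<Rightarrow> nat \<Rightarrow> 'g set" where
  "eigenspace \<sigma> N i = {a. \<sigma> a = exp (2 * of_real pi * \<i> / of_nat N) ^ i *\<^sub>c a}"

text \<open>A pair \<open>(f, c)\<close> encodes the element with loop part the sum over all integers \<open>n\<close> of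
  \<open>f n \<otimes> t^(n/N)\<close> and central part \<open>c\<cdot>k\<close>.\<close>

type_synonym 'g affine = "(int \<Rightarrow>\<^sub>0 'g) \<times> complex"

definition twisted_affine :: "('g::complex_vector \<Rightarrow> 'g) \<Rightarrow> nat \<Rightarrow> 'g affine set" where
  "twisted_affine \<sigma> N =
     {X. \<forall>n. Poly_Mapping.lookup (fst X) n \<in> eigenspace \<sigma> N (nat (n mod int N))}"

definition affine_bracket ::
    "('g::complex_vector \<Rightarrow> 'g \<Rightarrow> 'g) \<Rightarrow> ('g \<Rightarrow> 'g \<Rightarrow> complex) \<Rightarrow> nat \<Rightarrow>
     'g affine \<Rightarrow> 'g affine \<Rightarrow> 'g affine" where
  "affine_bracket br form N X Y =
     (\<Sum>m\<in>Poly_Mapping.keys (fst X). \<Sum>n\<in>Poly_Mapping.keys (fst Y).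
        (let a = Poly_Mapping.lookup (fst X) m; b = Poly_Mapping.lookup (fst Y) n in
          (Poly_Mapping.single (m + n) (br a b),
           if m = - n then of_int m / of_nat N * form a b else 0)))"

text \<open>\<open>loop_elt n a\<close> is \<open>a \<otimes> t^(n/N)\<close>.\<close>

definition loop_elt :: "int \<Rightarrow> 'g::complex_vector \<Rightarrow> 'g affine" where
  "loop_elt n a = (Poly_Mapping.single n a, 0)"

lemma affine_bracket_loop:
  assumes "cbilinear br" "cbilinear form"
  shows "affine_bracket br form N (loop_elt m a) (loop_elt n b) =
    (Poly_Mapping.single (m + n) (br a b),
     if m = - n then of_int m / of_nat N * form a b else 0)"
proof (cases "a = 0 \<or> b = 0")
  case True
  have "br 0 b = 0" "br a 0 = 0" "form 0 b = 0" "form a 0 = 0"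
    using assms unfolding cbilinear_def clinear_iff
    by (metis complex_vector.scale_zero_left)+
  with True show ?thesis by (auto simp: affine_bracket_def loop_elt_def zero_prod_def)
next
  case False
  then show ?thesis by (simp add: affine_bracket_def loop_elt_def)
qed

text \<open>The homogeneous components of \<open>a\<close>: they are unique, and exist for every \<open>a\<close> when
  \<open>\<sigma> ^^ N = id\<close>.\<close>

definition graded_components :: "('g::complex_vector \<Rightarrow> 'g) \<Rightarrow> nat \<Rightarrow> 'g \<Rightarrow> nat \<Rightarrow> 'g" where
  "graded_components \<sigma> N a = (THE d. (\<forall>i<N. d i \<in> eigenspace \<sigma> N i) \<and> (\<forall>i\<ge>N. d i = 0) \<and>
     a = (\<Sum>i<N. d i))"

lemma graded_components_unique:
  assumes \<sigma>: "clinear \<sigma>" and d: "\<And>i. i < N \<Longrightarrow> d i \<in> eigenspace \<sigma> N i"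
    and sum: "(\<Sum>i<N. d i) = 0" and j: "j < N"
  shows "d j = 0"
proof -
  define \<epsilon> where "\<epsilon> = exp (2 * of_real pi * \<i> / of_nat N :: complex)"
  interpret S: Vector_Spaces.linear scaleC scaleC \<sigma> by (rule \<sigma>)
  have N: "N > 0" using j by simp
  have \<epsilon>_pow: "\<epsilon> ^ k = cis (2 * pi * k / N)" for k
    unfolding \<epsilon>_def by (simp add: exp_of_nat_mult[symmetric] cis_conv_exp mult_ac)
  have pow: "(\<sigma> ^^ k) (d i) = (\<epsilon> ^ i) ^ k *\<^sub>c d i" if "i < N" for i k
  proof (induction k)
    case (Suc k)
    then show ?case
      using d[OF that] by (simp add: S.scale eigenspace_def \<epsilon>_def scaleC_scaleC mult_ac)
  qed (simp add: scaleC_one)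
  have shifted: "(\<Sum>i<N. (\<epsilon> ^ i) ^ k *\<^sub>c d i) = 0" for k
  proof -
    have "(\<sigma> ^^ k) (\<Sum>i<N. d i) = (\<Sum>i<N. (\<sigma> ^^ k) (d i))"
      by (induction k) (simp_all add: S.sum)
    moreover have "(\<sigma> ^^ k) 0 = 0" by (induction k) simp_all
    ultimately show ?thesis by (simp add: sum pow)
  qed
  define z where "z i = \<epsilon> ^ i / \<epsilon> ^ j" for i
  have \<epsilon>0: "\<epsilon> \<noteq> 0" by (simp add: \<epsilon>_def)
  have orth: "(\<Sum>k<N. z i ^ k) = (if i = j then of_nat N else 0)" if "i < N" for i
  proof (cases "i = j")
    case False
    have "z i \<noteq> 1"
    proof
      assume "z i = 1"
      then have "cis (2 * pi * i / N) = cis (2 * pi * j / N)"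
        using \<epsilon>0 by (simp add: z_def \<epsilon>_pow)
      then show False
        using False that j bij_betw_roots_unity[OF N]
        by (auto simp: bij_betw_def inj_on_def)
    qed
    moreover have "z i ^ N = 1"
    proof -
      have "(\<epsilon> ^ i) ^ N = 1" for i
        using N cis_multiple_2pi[of "of_nat i"] by (simp add: \<epsilon>_pow DeMoivre mult_ac)
      then show ?thesis by (simp add: z_def power_divide)
    qed
    ultimately show ?thesis using False by (simp add: sum_gp_strict)
  qed (simp add: z_def \<epsilon>0)
  have "0 = (\<Sum>k<N. (1 / (\<epsilon> ^ j) ^ k) *\<^sub>c (\<Sum>i<N. (\<epsilon> ^ i) ^ k *\<^sub>c d i))"
    by (simp add: shifted)
  also have "\<dots> = (\<Sum>k<N. \<Sum>i<N. z i ^ k *\<^sub>c d i)"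
    by (simp add: complex_vector.scale_sum_right scaleC_scaleC z_def power_divide)
  also have "\<dots> = (\<Sum>i<N. (\<Sum>k<N. z i ^ k) *\<^sub>c d i)"
    by (subst sum.swap) (simp add: complex_vector.scale_sum_left)
  also have "\<dots> = (\<Sum>i<N. if i = j then of_nat N *\<^sub>c d j else 0)"
    by (intro sum.cong) (auto simp: orth)
  also have "\<dots> = of_nat N *\<^sub>c d j" using j by simp
  finally show ?thesis using N by simp
qed

lemma graded_components_eigenspace:
  assumes \<sigma>: "clinear \<sigma>" and a: "a \<in> eigenspace \<sigma> N i" and i: "i < N"
  shows "graded_components \<sigma> N a = (\<lambda>j. if j = i then a else 0)"
  unfolding graded_components_def
proof (rule the_equality)
  interpret S: Vector_Spaces.linear scaleC scaleC \<sigma> by (rule \<sigma>)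
  let ?e = "\<lambda>j. if j = i then a else 0"
  show e: "(\<forall>j<N. ?e j \<in> eigenspace \<sigma> N j) \<and> (\<forall>j\<ge>N. ?e j = 0) \<and> a = (\<Sum>j<N. ?e j)"
    using a i by (auto simp: eigenspace_def)
  fix d assume d: "(\<forall>j<N. d j \<in> eigenspace \<sigma> N j) \<and> (\<forall>j\<ge>N. d j = 0) \<and> a = (\<Sum>j<N. d j)"
  have "d j - ?e j = 0" if "j < N" for j
  proof (rule graded_components_unique[OF \<sigma> _ _ that])
    show "d k - ?e k \<in> eigenspace \<sigma> N k" if "k < N" for k
      using d e that
      by (auto simp: eigenspace_def S.diff complex_vector.scale_right_diff_distrib)
    show "(\<Sum>k<N. d k - ?e k) = 0"
      using d e by (simp only: sum_subtractf) simp
  qed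
  then show "d = ?e"
    using d i by (intro ext) (metis eq_iff_diff_eq_0 linorder_not_less)
qed

text \<open>Formal series in \<open>x^(1/N)\<close> and \<open>x^(-1/N)\<close> are functions on the integers: the value at
  \<open>k\<close> is the coefficient of \<open>x^(k/N)\<close>.  The generating series \<open>a(x) w\<close> has the coefficient
  \<open>(a\<^sub>i \<otimes> t^(n/N)) w\<close>, with \<open>i = n mod N\<close>, at \<open>x^(-n/N-1)\<close>, and \<open>k/N = -n/N-1\<close> means
  \<open>n = -k-N\<close>.\<close>

definition gen_series ::
    "('g::complex_vector \<Rightarrow> 'g) \<Rightarrow> nat \<Rightarrow> ('g affine \<Rightarrow> 'w \<Rightarrow> 'w) \<Rightarrow> 'g \<Rightarrow> 'w \<Rightarrow> int \<Rightarrow> 'w" where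
  "gen_series \<sigma> N \<rho> a w k =
     (let n = - k - int N in \<rho> (loop_elt n (graded_components \<sigma> N a (nat (n mod int N)))) w)"

definition lower_truncated :: "(int \<Rightarrow> 'w::zero) \<Rightarrow> bool" where
  "lower_truncated s \<longleftrightarrow> (\<exists>K. \<forall>k<K. s k = 0)"

definition poly_times_series ::
    "nat \<Rightarrow> complex poly \<Rightarrow> (int \<Rightarrow> 'w::complex_vector) \<Rightarrow> int \<Rightarrow> 'w" where
  "poly_times_series N p s k =
     (\<Sum>j\<le>Polynomial.degree p. Polynomial.coeff p j *\<^sub>c s (k - int N * int j))"

definition category_R ::
    "('g::complex_vector \<Rightarrow> 'g \<Rightarrow> 'g) \<Rightarrow> ('g \<Rightarrow> 'g \<Rightarrow> complex) \<Rightarrow> ('g \<Rightarrow> 'g) \<Rightarrow> nat \<Rightarrow>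
     ('g affine \<Rightarrow> 'w::complex_vector \<Rightarrow> 'w) \<Rightarrow> bool" where
  "category_R br form \<sigma> N \<rho> \<longleftrightarrow>
     lie_module (twisted_affine \<sigma> N) (affine_bracket br form N) \<rho> \<and>
     (\<forall>a w. lower_truncated (gen_series \<sigma> N \<rho> a w))"

definition category_E ::
    "('g::complex_vector \<Rightarrow> 'g \<Rightarrow> 'g) \<Rightarrow> ('g \<Rightarrow> 'g \<Rightarrow> complex) \<Rightarrow> ('g \<Rightarrow> 'g) \<Rightarrow> nat \<Rightarrow>
     ('g affine \<Rightarrow> 'u::complex_vector \<Rightarrow> 'u) \<Rightarrow> bool" where
  "category_E br form \<sigma> N \<rho> \<longleftrightarrow>
     lie_module (twisted_affine \<sigma> N) (affine_bracket br form N) \<rho> \<and>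
     (\<exists>p::complex poly. p \<noteq> 0 \<and>
        (\<forall>a u k. poly_times_series N p (gen_series \<sigma> N \<rho> a u) k = 0))"

end

theory Submission
  imports Defs "HOL-Computational_Algebra.Fundamental_Theorem_Algebra"
begin

text \<open>If a polynomial \<open>g\<close> is a multiple of those annihilating \<open>U1\<close> and \<open>U2\<close> and \<open>g \<equiv> 1\<close> modulo
  \<open>t^M\<close>, then \<open>a \<otimes> t^(n/N) g(t)\<close> acts as zero on \<open>U1\<close> and \<open>U2\<close>, and for large \<open>M\<close> it acts as
  \<open>a \<otimes> t^(n/N)\<close> on any given finitely many vectors of \<open>W1\<close> and \<open>W2\<close>.  So an isomorphism of the
  tensor products commutes with the action on the first factors alone, hence also with the action
  on the second ones, and slicing it by linear functionals gives nonzero homomorphisms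
  \<open>W1 \<rightarrow> W2\<close> and \<open>U1 \<rightarrow> U2\<close>.  The central element is dealt with by showing that it acts as zero on
  \<open>U1\<close> and \<open>U2\<close>.  This needs a nonzero value of the form on some \<open>g_i \<times> g_-i\<close>, that is,
  invariance of the form under \<open>\<sigma>\<close>: the form is proportional to the Killing form, which does not
  vanish because \<open>ad t\<close> has a nonzero eigenvalue for the element \<open>t\<close> representing a long root.\<close>

text \<open>Such a \<open>g\<close> exists because \<open>n\<close> runs over all integers: the
  polynomials annihilating a module of category E are then closed under division by \<open>t\<close>
  as well as under multiples, so one of them has a nonzero constant term and is invertible modulo
  every \<open>t^M\<close>. A restricted module has no truncation bound common to all its vectors,
  so \<open>M\<close> depends on the vectors. This is why the separation argument speaks of finitely
  many vectors at a time, and why a tensor has to be shown to involve only finitely many vectors of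
  its first factor. Multiplication by \<open>g(t)\<close> modifies loop elements but offers no
  substitute for the central element; hence the latter must be shown to act as zero on the modules
  of category E.\<close>

lemma clinear_add: "clinear f \<Longrightarrow> f (x + y) = f x + f y"
  and clinear_scale: "clinear f \<Longrightarrow> f (c *\<^sub>c x) = c *\<^sub>c f x"
  by (simp_all add: clinear_iff)

lemma clinear_zero: "clinear f \<Longrightarrow> f 0 = 0"
  using clinear_scale[of f 0 0] by simp

lemma clinear_diff: "clinear f \<Longrightarrow> f (x - y) = f x - f y"
  using clinear_add[of f "x - y" y] by (simp add: algebra_simps)

lemma clinear_sum: "clinear f \<Longrightarrow> f (\<Sum>i\<in>I. g i) = (\<Sum>i\<in>I. f (g i))"
  by (induction I rule: infinite_finite_induct) (simp_all add: clinear_zero clinear_add)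

lemmas clinear_rules = clinear_add clinear_scale clinear_zero clinear_diff clinear_sum

lemma clinear_funpow: "clinear f \<Longrightarrow> clinear (f ^^ n)" for f :: "'a::complex_vector \<Rightarrow> 'a"
  by (induction n) (simp_all add: clinear_iff)

lemma clinear_inv:
  assumes f: "clinear f" "bij f"
  shows "clinear (inv f)"
proof -
  have "f (inv f z) = z" "inv f (f x) = x" for z x
    using f(2) by (simp_all add: bij_is_surj surj_f_inv_f bij_is_inj)
  then show ?thesis
    unfolding clinear_iff by (metis clinear_add[OF f(1)] clinear_scale[OF f(1)])
qed

lemma cbilinear_left: "cbilinear b \<Longrightarrow> clinear (\<lambda>x. b x y)"
  and cbilinear_right: "cbilinear b \<Longrightarrow> clinear (b x)"
  by (simp_all add: cbilinear_def)

lemma clinear_eq_on_span: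
  assumes "clinear f" "clinear g" "\<And>x. x \<in> B \<Longrightarrow> f x = g x" "x \<in> complex_vector.span B"
  shows "f x = g x"
  using assms(4)
  by (induction rule: complex_vector.span_induct_alt)
    (use assms(1-3) in \<open>simp_all add: clinear_rules\<close>)


section \<open>Generalized eigenspaces\<close>

definition shift_op :: "('a::complex_vector \<Rightarrow> 'a) \<Rightarrow> complex \<Rightarrow> 'a \<Rightarrow> 'a" where
  "shift_op A c x = A x - c *\<^sub>c x"

definition gen_eigenspace :: "('a::complex_vector \<Rightarrow> 'a) \<Rightarrow> complex \<Rightarrow> 'a set" where
  "gen_eigenspace A c = {x. \<exists>n. (shift_op A c ^^ n) x = 0}"

lemma clinear_shift_op: "clinear A \<Longrightarrow> clinear (shift_op A c)"
  by (simp add: clinear_iff shift_op_def algebra_simps complex_vector.scale_right_diff_distrib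
      scaleC_add_right)

lemma shift_op_funpow_zero_mono:
  assumes "clinear A" "(shift_op A c ^^ n) x = 0" "n \<le> m"
  shows "(shift_op A c ^^ m) x = 0"
proof -
  have "(shift_op A c ^^ (m - n + n)) x = 0"
    unfolding funpow_add
    using assms clinear_zero[OF clinear_funpow[OF clinear_shift_op[OF assms(1)]]] by simp
  then show ?thesis using assms(3) by simp
qed

lemma subspace_gen_eigenspace:
  assumes A: "clinear A"
  shows "complex_vector.subspace (gen_eigenspace A c)"
  unfolding complex_vector.subspace_def
proof (intro conjI ballI allI)
  have l: "clinear (shift_op A c ^^ n)" for n
    using A by (intro clinear_funpow clinear_shift_op)
  show "0 \<in> gen_eigenspace A c" by (auto simp: gen_eigenspace_def clinear_zero[OF l])
  fix x y k assume x: "x \<in> gen_eigenspace A c" and "y \<in> gen_eigenspace A c"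
  then obtain n m where "(shift_op A c ^^ n) x = 0" "(shift_op A c ^^ m) y = 0"
    by (auto simp: gen_eigenspace_def)
  then have "(shift_op A c ^^ max n m) (x + y) = 0"
    using A by (simp add: clinear_add[OF l] shift_op_funpow_zero_mono[OF A])
  then show "x + y \<in> gen_eigenspace A c" by (auto simp: gen_eigenspace_def)
  show "k *\<^sub>c x \<in> gen_eigenspace A c"
    using x by (auto simp: gen_eigenspace_def clinear_scale[OF l])
qed

lemma gen_eigenspace_shift_iff:
  "shift_op A c x \<in> gen_eigenspace A c \<longleftrightarrow> x \<in> gen_eigenspace A c"  if "clinear A"
proof
  assume "shift_op A c x \<in> gen_eigenspace A c"
  then obtain n where "(shift_op A c ^^ Suc n) x = 0"
    by (auto simp: gen_eigenspace_def funpow_swap1)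
  then show "x \<in> gen_eigenspace A c" unfolding gen_eigenspace_def by blast
next
  assume "x \<in> gen_eigenspace A c"
  then obtain n where "(shift_op A c ^^ n) x = 0" by (auto simp: gen_eigenspace_def)
  then have "(shift_op A c ^^ n) (shift_op A c x) = 0"
    by (simp add: funpow_swap1[symmetric] clinear_zero[OF clinear_shift_op[OF that]])
  then show "shift_op A c x \<in> gen_eigenspace A c" unfolding gen_eigenspace_def by blast
qed

lemma gen_eigenspace_invariant:
  assumes A: "clinear A" and x: "x \<in> gen_eigenspace A c"
  shows "A x \<in> gen_eigenspace A c"
proof -
  have "A x = shift_op A c x + c *\<^sub>c x" by (simp add: shift_op_def)
  then show ?thesis
    using A x subspace_gen_eigenspace[OF A, of c]
    by (simp add: gen_eigenspace_shift_iff complex_vector.subspace_add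
        complex_vector.subspace_scale)
qed

text \<open>On the generalized eigenspace of \<open>c\<close>, the operator \<open>A - a\<close> is
  the nilpotent \<open>A - c\<close> plus the nonzero scalar \<open>c - a\<close>, hence invertible.
  The induction on the nilpotency index builds the preimage.\<close>

lemma shift_op_onto_gen_eigenspace:
  assumes A: "clinear A" and "c \<noteq> a" "(shift_op A c ^^ n) u = 0"
  shows "\<exists>y\<in>gen_eigenspace A c. shift_op A a y = u"
  using assms(3)
proof (induction n arbitrary: u)
  case 0
  have "0 \<in> gen_eigenspace A c"
    using subspace_gen_eigenspace[OF A] by (rule complex_vector.subspace_0)
  then show ?case using 0 clinear_zero[OF clinear_shift_op[OF A]] by auto
next
  case (Suc n)
  from Suc.prems have u: "u \<in> gen_eigenspace A c" unfolding gen_eigenspace_def by blast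
  have "(shift_op A c ^^ n) (shift_op A c u) = 0" using Suc.prems by (simp add: funpow_swap1)
  then obtain y where y: "y \<in> gen_eigenspace A c" "shift_op A a y = shift_op A c u"
    using Suc.IH by blast
  \<comment> \<open>Here \<open>y\<close> is a preimage of \<open>(A - c) u\<close> under
    \<open>A - a\<close>, and \<open>(A - a) u - (A - c) u = (c - a) u\<close>.\<close>
  let ?y = "(1 / (c - a)) *\<^sub>c (u - y)"
  have "shift_op A a ?y = (1 / (c - a)) *\<^sub>c (shift_op A a u - shift_op A c u)"
    using y(2) by (simp add: clinear_rules[OF clinear_shift_op[OF A]])
  also have "shift_op A a u - shift_op A c u = (c - a) *\<^sub>c u"
    by (simp add: shift_op_def complex_vector.scale_left_diff_distrib)
  finally have "shift_op A a ?y = u"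
    using \<open>c \<noteq> a\<close> by (simp add: scaleC_scaleC scaleC_one)
  moreover have "?y \<in> gen_eigenspace A c"
    using subspace_gen_eigenspace[OF A] u y(1)
    by (intro complex_vector.subspace_scale complex_vector.subspace_diff)
  ultimately show ?case by blast
qed

text \<open>Solve \<open>(A - a) y = u\<close> summand by summand: for eigenvalues other than
  \<open>a\<close> this is possible exactly, and a summand belonging to \<open>a\<close> is left as
  the error.\<close>

lemma span_gen_eigenspaces_shift:
  assumes A: "clinear A" and u: "u \<in> complex_vector.span (\<Union>c. gen_eigenspace A c)"
  shows "\<exists>y\<in>complex_vector.span (\<Union>c. gen_eigenspace A c). shift_op A a y - u \<in> gen_eigenspace A a"
  using u
proof (induction rule: complex_vector.span_induct_alt)
  case base
  have "shift_op A a 0 - 0 = 0" using clinear_zero[OF clinear_shift_op[OF A]] by simp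
  then show ?case
    using complex_vector.span_zero complex_vector.subspace_0[OF subspace_gen_eigenspace[OF A]]
    by metis
next
  case (step k v u)
  let ?S = "complex_vector.span (\<Union>c. gen_eigenspace A c)"
  obtain y where y: "y \<in> ?S" "shift_op A a y - u \<in> gen_eigenspace A a" using step.IH by blast
  obtain c where c: "v \<in> gen_eigenspace A c" using step.hyps by blast
  show ?case
  proof (cases "c = a")
    case True
    have "shift_op A a y - (k *\<^sub>c v + u) = (shift_op A a y - u) - k *\<^sub>c v" by simp
    then show ?thesis
      using y c True subspace_gen_eigenspace[OF A]
      by (metis complex_vector.subspace_diff complex_vector.subspace_scale)
  next
    case False
    then obtain z where z: "z \<in> gen_eigenspace A c" "shift_op A a z = v"
      using shift_op_onto_gen_eigenspace[OF A False] c unfolding gen_eigenspace_def by blast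
    have "shift_op A a (k *\<^sub>c z + y) - (k *\<^sub>c v + u) = shift_op A a y - u"
      using z(2) by (simp add: clinear_rules[OF clinear_shift_op[OF A]])
    moreover have "k *\<^sub>c z + y \<in> ?S"
      using z(1) y(1) by (intro complex_vector.span_add complex_vector.span_scale)
        (auto intro: complex_vector.span_base)
    ultimately show ?thesis using y(2) by metis
  qed
qed

section \<open>Polynomials in an operator, evaluated by Horner's scheme\<close>

definition poly_act :: "('a::complex_vector \<Rightarrow> 'a) \<Rightarrow> complex poly \<Rightarrow> 'a \<Rightarrow> 'a" where
  "poly_act A p x = fold_coeffs (\<lambda>c y. c *\<^sub>c x + A y) p 0"

lemma poly_act_0 [simp]: "poly_act A 0 x = 0"
  by (simp add: poly_act_def)

lemma poly_act_pCons: "clinear A \<Longrightarrow> poly_act A (pCons c p) x = c *\<^sub>c x + A (poly_act A p x)"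
  by (cases "p = 0 \<and> c = 0") (auto simp: poly_act_def clinear_zero)

lemma poly_act_linear_factor:
  assumes "clinear A"
  shows "poly_act A ([:- a, 1:] * q) x = poly_act A q (shift_op A a x)"
proof (induction q)
  case (pCons c q)
  have "poly_act A ([:- a, 1:] * pCons c q) x
      = poly_act A (pCons 0 ([:- a, 1:] * q) + smult c [:- a, 1:]) x"
    by (simp add: algebra_simps)
  have e: "[:- a, 1:] * pCons c q = pCons (- a * c) ([:c:] + [:- a, 1:] * q)"
    by simp
  have g: "poly_act A ([:c:] + r) x = c *\<^sub>c x + poly_act A r x" for r
    by (cases r) (simp add: assms poly_act_pCons clinear_zero[OF assms] scaleC_add_left)
  show ?case
    unfolding e poly_act_pCons[OF assms] g pCons.IH
    by (simp add: clinear_rules[OF assms] shift_op_def complex_vector.scale_right_diff_distrib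
        scaleC_scaleC mult.commute)
qed simp

text \<open>Split off a root \<open>a\<close> of \<open>p\<close>: by induction
  \<open>(A - a) w\<close> lies in the span, so it equals \<open>(A - a) y\<close> up to the
  generalized eigenspace of \<open>a\<close> for some \<open>y\<close> in the span. Then
  \<open>y - w\<close> is itself in that eigenspace.\<close>

lemma poly_act_zero_imp_span:
  assumes A: "clinear A" and "p \<noteq> 0" "poly_act A p w = 0"
  shows "w \<in> complex_vector.span (\<Union>c. gen_eigenspace A c)"
  using assms(2,3)
proof (induction "Polynomial.degree p" arbitrary: p w)
  case 0
  then obtain c where "p = [:c:]" "c \<noteq> 0" by (metis degree_eq_zeroE pCons_0_0)
  then have "w = 0" using 0 by (simp add: poly_act_pCons[OF A] clinear_zero[OF A])
  then show ?case by (simp add: complex_vector.span_zero)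
next
  case (Suc d)
  let ?S = "complex_vector.span (\<Union>c. gen_eigenspace A c)"
  have "\<not> constant (poly p)" using Suc.hyps(2) by (simp add: constant_degree)
  then obtain a where "poly p a = 0" using fundamental_theorem_of_algebra by blast
  then obtain q where q: "p = [:- a, 1:] * q" by (auto simp: poly_eq_0_iff_dvd dvd_def)
  have "q \<noteq> 0" using q Suc.prems by auto
  then have "Polynomial.degree p = Suc (Polynomial.degree q)"
    unfolding q by (subst degree_mult_eq) auto
  then have "shift_op A a w \<in> ?S"
    using Suc.hyps Suc.prems \<open>q \<noteq> 0\<close> poly_act_linear_factor[OF A] q by simp
  then obtain y where y: "y \<in> ?S" "shift_op A a y - shift_op A a w \<in> gen_eigenspace A a"
    using span_gen_eigenspaces_shift[OF A] by blast
  then have "y - w \<in> gen_eigenspace A a"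
    using gen_eigenspace_shift_iff[OF A, of a "y - w"]
    by (simp add: clinear_diff[OF clinear_shift_op[OF A]])
  then have "y - w \<in> ?S" by (intro complex_vector.span_base) blast
  from complex_vector.span_diff[OF y(1) this] have "y - (y - w) \<in> ?S" .
  then show ?case by simp
qed

lemma ex_poly_act_zero:
  fixes A :: "'a::complex_vector \<Rightarrow> 'a"
  assumes A: "clinear A" and fin: "finite B" "complex_vector.span B = (UNIV :: 'a set)"
  shows "\<exists>p. p \<noteq> 0 \<and> poly_act A p w = 0"
proof -
  have act_sum: "poly_act A p w = (\<Sum>j\<le>n. Polynomial.coeff p j *\<^sub>c (A ^^ j) w)"
    if "Polynomial.degree p \<le> n" for p n
    using that
  proof (induction p arbitrary: n)
    case (pCons c p)
    show ?case
    proof (cases n)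
      case 0
      with pCons have "p = 0" by (auto split: if_splits)
      then show ?thesis using 0 by (simp add: poly_act_pCons[OF A] clinear_zero[OF A])
    next
      case (Suc m)
      then have "Polynomial.degree p \<le> m" using pCons by (auto split: if_splits)
      then show ?thesis
        unfolding Suc sum.atMost_Suc_shift poly_act_pCons[OF A]
        by (simp add: pCons.IH clinear_rules[OF A])
    qed
  qed simp
  \<comment> \<open>Linear dependence is a property of sets, so a repetition among the iterates of
    \<open>w\<close> is a case of its own; it gives the polynomial \<open>X^j - X^i\<close>.\<close>
  show ?thesis
  proof (cases "inj (\<lambda>j. (A ^^ j) w)")
    case True
    let ?v = "\<lambda>j. (A ^^ j) w"
    let ?I = "{..card B}"
    have "complex_vector.dependent (?v ` ?I)"
    proof (rule ccontr)
      assume "\<not> ?thesis"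
      then have "card (?v ` ?I) \<le> card B"
        using complex_vector.independent_span_bound[OF fin(1)] fin(2) by blast
      moreover have "card (?v ` ?I) = Suc (card B)"
        using card_image[OF inj_on_subset[OF True]] by simp
      ultimately show False by simp
    qed
    then obtain u where u: "\<exists>v\<in>?v ` ?I. u v \<noteq> 0" "(\<Sum>v\<in>?v ` ?I. u v *\<^sub>c v) = 0"
      using complex_vector.dependent_finite[of "?v ` ?I"] by auto
    let ?p = "\<Sum>j\<in>?I. Polynomial.monom (u (?v j)) j"
    have c: "Polynomial.coeff ?p j = (if j \<le> card B then u (?v j) else 0)" for j
      by (simp add: Polynomial.coeff_sum if_distrib cong: if_cong)
    have d: "Polynomial.degree ?p \<le> card B"
      by (rule degree_le) (simp add: c)
    have "poly_act A ?p w = (\<Sum>j\<in>?I. u (?v j) *\<^sub>c ?v j)"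
      unfolding act_sum[OF d] by (intro sum.cong) (simp_all add: c)
    also have "\<dots> = (\<Sum>v\<in>?v ` ?I. u v *\<^sub>c v)"
      by (subst sum.reindex[OF inj_on_subset[OF True]]) auto
    finally have "poly_act A ?p w = 0" using u(2) by simp
    moreover have "?p \<noteq> 0"
    proof
      assume "?p = 0"
      then have "u (?v j) = 0" if "j \<le> card B" for j using c[of j] that by simp
      then show False using u(1) by auto
    qed
    ultimately show ?thesis by blast
  next
    case False
    then obtain i j where ij: "i < j" "(A ^^ i) w = (A ^^ j) w"
      unfolding inj_def by (metis linorder_neqE_nat)
    let ?p = "Polynomial.monom 1 j - Polynomial.monom 1 i :: complex poly"
    have d: "Polynomial.degree ?p \<le> j"
      using ij(1) by (intro degree_le) simp
    have "poly_act A ?p w = (\<Sum>k\<le>j. (if k = j then (A ^^ j) w else 0) - (if k = i then (A ^^ i) w else 0))"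
      unfolding act_sum[OF d]
      by (intro sum.cong) (auto simp: complex_vector.scale_left_diff_distrib scaleC_one)
    also have "\<dots> = 0" using ij by (simp add: sum_subtractf)
    finally have "poly_act A ?p w = 0" .
    moreover have "Polynomial.coeff ?p j \<noteq> 0" using ij(1) by simp
    then have "?p \<noteq> 0" by (metis coeff_0)
    ultimately show ?thesis by blast
  qed
qed

lemma span_gen_eigenspaces:
  fixes A :: "'a::complex_vector \<Rightarrow> 'a"
  assumes "clinear A" "finite B" "complex_vector.span B = (UNIV :: 'a set)"
  shows "complex_vector.span (\<Union>c. gen_eigenspace A c) = UNIV"
  using ex_poly_act_zero[OF assms] poly_act_zero_imp_span[OF assms(1)] by blast

lemma ex_eigenvector:
  fixes A :: "'a::complex_vector \<Rightarrow> 'a"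
  assumes A: "clinear A" and fin: "finite B" "complex_vector.span B = (UNIV :: 'a set)"
    and nz: "(z :: 'a) \<noteq> 0"
  shows "\<exists>c x. x \<noteq> 0 \<and> A x = c *\<^sub>c x"
proof -
  have "\<exists>c. \<not> gen_eigenspace A c \<subseteq> {0}"
  proof (rule ccontr)
    assume "\<not> ?thesis"
    then have "complex_vector.span (\<Union>c. gen_eigenspace A c) \<subseteq> {0}"
      by (intro complex_vector.span_minimal complex_vector.subspace_single_0) auto
    then show False using nz span_gen_eigenspaces[OF A fin] by blast
  qed
  then obtain c x where x: "x \<in> gen_eigenspace A c" "x \<noteq> 0" by blast
  then obtain n where "(shift_op A c ^^ n) x = 0" by (auto simp: gen_eigenspace_def)
  then obtain m where m: "(shift_op A c ^^ m) x \<noteq> 0" "(shift_op A c ^^ Suc m) x = 0"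
    using x(2) by (induction n) auto
  have "shift_op A c ((shift_op A c ^^ m) x) = 0" using m(2) by simp
  then have "A ((shift_op A c ^^ m) x) = c *\<^sub>c (shift_op A c ^^ m) x" by (simp add: shift_op_def)
  then show ?thesis using m(1) by blast
qed

text \<open>On a genuine eigenvector for \<open>b\<close>, \<open>A - a\<close> is the nonzero
  scalar \<open>b - a\<close>, so no power of it vanishes there. The general case descends to this
  one because \<open>A - b\<close> preserves the generalized eigenspace of \<open>a\<close>.\<close>

lemma gen_eigenspaces_disjoint:
  assumes A: "clinear A" and ab: "a \<noteq> b" and x: "x \<in> gen_eigenspace A a" "x \<in> gen_eigenspace A b"
  shows "x = 0"
proof -
  have step: "y = 0" if y: "y \<in> gen_eigenspace A a" "shift_op A b y = 0" for y
  proof -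
    have s: "shift_op A a y = (b - a) *\<^sub>c y"
      using y(2) by (simp add: shift_op_def complex_vector.scale_left_diff_distrib)
    have "(shift_op A a ^^ n) y = (b - a) ^ n *\<^sub>c y" for n
      by (induction n)
        (simp_all add: scaleC_one s clinear_scale[OF clinear_shift_op[OF A]] scaleC_scaleC mult.commute)
    then show ?thesis using y(1) ab by (auto simp: gen_eigenspace_def)
  qed
  have inv: "shift_op A b y \<in> gen_eigenspace A a" if "y \<in> gen_eigenspace A a" for y
    unfolding shift_op_def
    using that gen_eigenspace_invariant[OF A that] subspace_gen_eigenspace[OF A, of a]
    by (simp add: complex_vector.subspace_diff complex_vector.subspace_scale)
  obtain n where "(shift_op A b ^^ n) x = 0" using x(2) by (auto simp: gen_eigenspace_def)
  then show ?thesis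
    using x(1)
  proof (induction n arbitrary: x)
    case (Suc n)
    then have "shift_op A b x = 0" using inv by (simp add: funpow_swap1)
    then show ?case using step Suc by blast
  qed simp
qed

text \<open>A power of \<open>A - f\<close> that kills the summand at \<open>f\<close> leaves a
  relation among the other summands. By induction that power kills each of them too, and
  \<open>gen_eigenspaces_disjoint\<close> applies.\<close>

lemma gen_eigenspaces_independent:
  assumes A: "clinear A" and "finite F" "\<And>e. e \<in> F \<Longrightarrow> x e \<in> gen_eigenspace A e"
    and "(\<Sum>e\<in>F. x e) = 0" "e \<in> F"
  shows "x e = 0"
  using assms(2-)
proof (induction F arbitrary: x e rule: finite_induct)
  case (insert f F)
  obtain n where n: "(shift_op A f ^^ n) (x f) = 0"
    using insert.prems(1)[of f] by (auto simp: gen_eigenspace_def)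
  let ?D = "shift_op A f ^^ n"
  have D: "clinear ?D" using A by (intro clinear_funpow clinear_shift_op)
  have inv: "(shift_op A f ^^ n) y \<in> gen_eigenspace A e" if "y \<in> gen_eigenspace A e" for n y e
  proof (induction n)
    case (Suc n)
    then show ?case
      using gen_eigenspace_invariant[OF A Suc] subspace_gen_eigenspace[OF A, of e]
      by (simp add: shift_op_def complex_vector.subspace_diff complex_vector.subspace_scale)
  qed (use that in simp)
  have "(\<Sum>e\<in>F. ?D (x e)) = ?D (\<Sum>e\<in>insert f F. x e)"
    using insert.hyps n by (simp add: clinear_rules[OF D])
  then have "(\<Sum>e\<in>F. ?D (x e)) = 0" using insert.prems(2) by (simp add: clinear_zero[OF D])
  then have "?D (x e) = 0" if "e \<in> F" for e
    using insert.IH[of "\<lambda>e. ?D (x e)"] inv insert.prems(1) that by blast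
  then have 0: "x e = 0" if "e \<in> F" for e
    using gen_eigenspaces_disjoint[OF A, of e f] that insert.hyps(2) insert.prems(1)[of e]
    unfolding gen_eigenspace_def by (metis (mono_tags, lifting) insertCI mem_Collect_eq)
  then show ?case using insert.prems insert.hyps by auto
qed simp


section \<open>Triangular bases\<close>

lemma clinear_maps_span:
  assumes "clinear A" "\<And>x. x \<in> S \<Longrightarrow> A x \<in> complex_vector.span T"
    and "x \<in> complex_vector.span S"
  shows "A x \<in> complex_vector.span T"
  using assms(3)
  by (induction rule: complex_vector.span_induct_alt)
    (use assms(1,2) in \<open>simp_all add: clinear_rules complex_vector.span_zero
      complex_vector.span_add complex_vector.span_scale\<close>)

text \<open>This supplies the next vector of a triangular basis. Some generalized eigenvector lies
  outside \<open>S\<close>, since these vectors span; apply \<open>A - a\<close> to it until one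
  more application would land in \<open>S\<close>.\<close>

lemma ex_gen_eigenvector_modulo:
  fixes A :: "'a::complex_vector \<Rightarrow> 'a"
  assumes A: "clinear A" and fin: "finite B" "complex_vector.span B = (UNIV :: 'a set)"
    and S: "complex_vector.subspace S" "S \<noteq> UNIV"
  shows "\<exists>v a. v \<notin> S \<and> v \<in> gen_eigenspace A a \<and> shift_op A a v \<in> S"
proof -
  have "\<not> (\<Union>a. gen_eigenspace A a) \<subseteq> S"
    using complex_vector.span_minimal[OF _ S(1)] span_gen_eigenspaces[OF A fin] S(2) by blast
  then obtain a w where w: "w \<in> gen_eigenspace A a" "w \<notin> S" by blast
  let ?D = "shift_op A a"
  obtain n where n: "(?D ^^ n) w = 0" using w(1) by (auto simp: gen_eigenspace_def)
  have "\<exists>m. (?D ^^ m) w \<notin> S \<and> (?D ^^ Suc m) w \<in> S"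
  proof (rule ccontr)
    assume neg: "\<not> ?thesis"
    have "(?D ^^ m) w \<notin> S" for m
      by (induction m) (use neg w(2) in auto)
    then show False using n complex_vector.subspace_0[OF S(1)] by metis
  qed
  then obtain m where m: "(?D ^^ m) w \<notin> S" "?D ((?D ^^ m) w) \<in> S" by auto
  have "(?D ^^ m) w \<in> gen_eigenspace A a"
    by (induction m) (simp_all add: w(1) gen_eigenspace_shift_iff[OF A])
  then show ?thesis using m by blast
qed

text \<open>A basis as produced by the Jordan normal form: the operator is triangular, and the second
  condition records the diagonal entries.\<close>

lemma ex_triangular_basis:
  fixes A :: "'a::complex_vector \<Rightarrow> 'a"
  assumes A: "clinear A" and fin: "finite B0" "complex_vector.span B0 = (UNIV :: 'a set)"
  obtains B ev where "finite B" "complex_vector.independent B" "complex_vector.span B = UNIV"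
    "\<And>b. b \<in> B \<Longrightarrow> b \<in> gen_eigenspace A (ev b)"
    "\<And>b. b \<in> B \<Longrightarrow> shift_op A (ev b) b \<in> complex_vector.span (B - {b})"
proof -
  \<comment> \<open>A largest set with these properties must span, as otherwise it could be enlarged
    by \<open>ex_gen_eigenvector_modulo\<close>. Triangularity is stated without an order on the
    basis, through \<open>span (S - {b})\<close>, so it survives adding vectors.\<close>
  define P where "P S \<longleftrightarrow> complex_vector.independent S \<and>
     (\<forall>x\<in>complex_vector.span S. A x \<in> complex_vector.span S) \<and>
     (\<forall>b\<in>S. \<exists>a. b \<in> gen_eigenspace A a \<and> shift_op A a b \<in> complex_vector.span (S - {b}))" for S
  have bound: "finite S \<and> card S \<le> card B0" if "P S" for S
    using complex_vector.independent_span_bound[OF fin(1)] that fin(2) by (auto simp: P_def)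
  have "P {}" by (simp add: P_def clinear_zero[OF A] complex_vector.independent_empty)
  then obtain S where S: "P S" "\<And>S'. P S' \<Longrightarrow> card S' \<le> card S"
    using ex_has_greatest_nat[of P "{}" card "Suc (card B0)"] bound by (meson le_imp_less_Suc)
  have "complex_vector.span S = UNIV"
  proof (rule ccontr)
    assume "complex_vector.span S \<noteq> UNIV"
    then obtain v a where v: "v \<notin> complex_vector.span S" "v \<in> gen_eigenspace A a"
      "shift_op A a v \<in> complex_vector.span S"
      using ex_gen_eigenvector_modulo[OF A fin complex_vector.subspace_span] by blast
    have sub: "complex_vector.span S \<subseteq> complex_vector.span (insert v S)"
      by (rule complex_vector.span_mono) auto
    have vS: "v \<notin> S" using v(1) complex_vector.span_base by blast
    have "P (insert v S)"
      unfolding P_def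
    proof (intro conjI ballI)
      show "complex_vector.independent (insert v S)"
        using S(1) v(1) by (simp add: P_def complex_vector.independent_insert)
      fix x assume x: "x \<in> complex_vector.span (insert v S)"
      have "A v = shift_op A a v + a *\<^sub>c v" by (simp add: shift_op_def)
      also have "\<dots> \<in> complex_vector.span (insert v S)"
        using v(3) sub
        by (auto intro!: complex_vector.span_add complex_vector.span_scale
            intro: complex_vector.span_base)
      finally have "A b \<in> complex_vector.span (insert v S)" if "b \<in> insert v S" for b
        using S(1) sub that by (auto simp: P_def intro: complex_vector.span_base)
      then show "A x \<in> complex_vector.span (insert v S)"
        using clinear_maps_span[OF A _ x] by blast
    next
      fix b assume b: "b \<in> insert v S"
      show "\<exists>a. b \<in> gen_eigenspace A a \<and>
          shift_op A a b \<in> complex_vector.span (insert v S - {b})"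
      proof (cases "b = v")
        case True
        then show ?thesis using v vS by (intro exI[of _ a]) simp
      next
        case False
        then obtain c where "b \<in> gen_eigenspace A c" "shift_op A c b \<in> complex_vector.span (S - {b})"
          using b S(1) by (auto simp: P_def)
        moreover have "complex_vector.span (S - {b}) \<subseteq> complex_vector.span (insert v S - {b})"
          by (rule complex_vector.span_mono) auto
        ultimately show ?thesis by blast
      qed
    qed
    then have "card (insert v S) \<le> card S" using S(2) by blast
    then show False using vS bound[OF S(1)] by simp
  qed
  moreover obtain ev where "\<forall>b\<in>S. b \<in> gen_eigenspace A (ev b) \<and>
      shift_op A (ev b) b \<in> complex_vector.span (S - {b})"
    using S(1) unfolding P_def by metis
  ultimately show ?thesis using S(1) bound by (intro that[of S ev]) (auto simp: P_def)
qed


section \<open>Traces\<close>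

locale finite_basis =
  fixes B :: "'a::complex_vector set"
  assumes finite: "finite B" and independent: "complex_vector.independent B"
    and span: "complex_vector.span B = UNIV"
begin

abbreviation coord :: "'a \<Rightarrow> 'a \<Rightarrow> complex" where
  "coord \<equiv> complex_vector.representation B"

lemma coord_add: "coord (x + y) b = coord x b + coord y b"
  and coord_scale: "coord (c *\<^sub>c x) b = c * coord x b"
  and coord_diff: "coord (x - y) b = coord x b - coord y b"
  and coord_basis: "d \<in> B \<Longrightarrow> coord d b = (if b = d then 1 else 0)"
  using independent span
  by (simp_all add: complex_vector.representation_add complex_vector.representation_scale
      complex_vector.representation_diff complex_vector.representation_basis)

lemma coord_sum: "coord (\<Sum>i\<in>I. f i) b = (\<Sum>i\<in>I. coord (f i) b)"
  using independent span by (simp add: complex_vector.representation_sum)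

lemma coord_expand: "(\<Sum>b\<in>B. coord x b *\<^sub>c b) = x"
  using complex_vector.sum_representation_eq[OF independent _ finite subset_refl] span by simp

lemma coord_span: "x \<in> complex_vector.span S \<Longrightarrow> S \<subseteq> B \<Longrightarrow> b \<notin> S \<Longrightarrow> coord x b = 0"
  by (induction rule: complex_vector.span_induct_alt)
    (auto simp: complex_vector.representation_zero coord_add coord_scale coord_basis subsetD)

lemma basis_extension:
  assumes "clinear f" "clinear g" "\<And>b. b \<in> B \<Longrightarrow> f b = g b"
  shows "f x = g x"
  using clinear_eq_on_span[OF assms] span by blast

definition trace :: "('a \<Rightarrow> 'a) \<Rightarrow> complex" where
  "trace f = (\<Sum>b\<in>B. coord (f b) b)"

lemma trace_commute:
  assumes f: "clinear f" and g: "clinear g"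
  shows "trace (\<lambda>x. f (g x)) = trace (\<lambda>x. g (f x))"
proof -
  have expand: "trace (\<lambda>x. f (g x)) = (\<Sum>b\<in>B. \<Sum>c\<in>B. coord (g b) c * coord (f c) b)"
    if f: "clinear f" for f g :: "'a \<Rightarrow> 'a"
    unfolding trace_def
  proof (rule sum.cong)
    fix b
    have "coord (f (g b)) b = coord (f (\<Sum>c\<in>B. coord (g b) c *\<^sub>c c)) b"
      by (simp add: coord_expand)
    also have "\<dots> = (\<Sum>c\<in>B. coord (g b) c * coord (f c) b)"
      by (simp only: clinear_rules[OF f] coord_sum coord_scale)
    finally show "coord (f (g b)) b = (\<Sum>c\<in>B. coord (g b) c * coord (f c) b)" .
  qed simp
  show ?thesis
    unfolding expand[OF f] expand[OF g] by (subst sum.swap) (simp add: mult.commute)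
qed

lemma trace_add: "trace (\<lambda>x. f x + g x) = trace f + trace g"
  and trace_diff: "trace (\<lambda>x. f x - g x) = trace f - trace g"
  and trace_scale: "trace (\<lambda>x. c *\<^sub>c f x) = c * trace f"
  by (simp_all add: trace_def coord_add coord_diff coord_scale sum.distrib sum_subtractf
      sum_distrib_left)

end


section \<open>The Killing form\<close>

context lie_algebra
begin

lemmas br_linear = cbilinear_left[OF bilinear] cbilinear_right[OF bilinear]

lemmas br_simps = clinear_add[OF br_linear(1)] clinear_add[OF br_linear(2)]
  clinear_scale[OF br_linear(1)] clinear_scale[OF br_linear(2)]
  clinear_zero[OF br_linear(1)] clinear_zero[OF br_linear(2)]
  clinear_diff[OF br_linear(1)] clinear_diff[OF br_linear(2)]

lemma antisymmetric: "br x y = - br y x"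
proof -
  have "br x x + br y x + (br x y + br y y) = br (x + y) (x + y)"
    by (simp only: br_simps)
  then show ?thesis by (simp add: alternating eq_neg_iff_add_eq_0 add.commute)
qed

lemma br_neg: "br (- x) y = - br x y" "br x (- y) = - br x y"
  using br_simps(7)[of 0 x y] br_simps(8)[of x 0 y] by (simp_all add: br_simps)

lemma ad_br: "br (br x y) z = br x (br y z) - br y (br x z)"
  using jacobi[of x y z] antisymmetric[of z "br x y"] antisymmetric[of z x]
  by (simp add: br_neg algebra_simps eq_neg_iff_add_eq_0)

lemma derivation: "br x (br y z) = br (br x y) z + br y (br x z)"
  by (simp add: ad_br)

text \<open>Since \<open>ad t\<close> is a derivation, \<open>ad t - (a + b)\<close> maps
  \<open>br x y\<close> to \<open>br ((ad t - a) x) y + br x ((ad t - b) y)\<close>. Each term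
  lowers the sum of the two nilpotency exponents, which is the induction measure.\<close>

lemma br_gen_eigenspaces:
  assumes "x \<in> gen_eigenspace (br t) a" "y \<in> gen_eigenspace (br t) b"
  shows "br x y \<in> gen_eigenspace (br t) (a + b)"
proof -
  let ?D = "shift_op (br t)"
  have D: "?D (a + b) (br x y) = br (?D a x) y + br x (?D b y)" for x y
    by (simp add: shift_op_def br_simps derivation[of t x y] scaleC_add_left)
  have "br x y \<in> gen_eigenspace (br t) (a + b)"
    if "(?D a ^^ n) x = 0" "(?D b ^^ m) y = 0" for n m x y
    using that
  proof (induction "n + m" arbitrary: n m x y rule: less_induct)
    case less
    let ?G = "gen_eigenspace (br t) (a + b)"
    have sub: "complex_vector.subspace ?G" by (rule subspace_gen_eigenspace[OF br_linear(2)])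
    show ?case
    proof (cases "n = 0 \<or> m = 0")
      case True
      then have "br x y = 0" using less.prems by (auto simp: br_simps)
      then show ?thesis using complex_vector.subspace_0[OF sub] by simp
    next
      case False
      then obtain n' m' where nm: "n = Suc n'" "m = Suc m'" by (metis not0_implies_Suc)
      have "br (?D a x) y \<in> ?G"
        using less.hyps[of n' m "?D a x" y] less.prems nm by (simp add: funpow_swap1)
      moreover have "br x (?D b y) \<in> ?G"
        using less.hyps[of n m' x "?D b y"] less.prems nm by (simp add: funpow_swap1)
      ultimately have "?D (a + b) (br x y) \<in> ?G"
        unfolding D by (rule complex_vector.subspace_add[OF sub])
      then show ?thesis by (simp add: gen_eigenspace_shift_iff[OF br_linear(2)])
    qed
  qed
  then show ?thesis using assms by (auto simp: gen_eigenspace_def)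
qed

end

locale lie_algebra_basis = lie_algebra br + finite_basis B
  for br :: "'g::complex_vector \<Rightarrow> 'g \<Rightarrow> 'g" and B :: "'g set"
begin

definition killing :: "'g \<Rightarrow> 'g \<Rightarrow> complex" where
  "killing x y = trace (\<lambda>z. br x (br y z))"

lemma cbilinear_killing: "cbilinear killing"
  unfolding cbilinear_def clinear_iff
  by (simp add: killing_def br_simps trace_add trace_scale scaleC_complex_def)

text \<open>Expanding both sides by \<open>ad_br\<close> leaves the traces of
  \<open>ad y ad x ad z\<close> and \<open>ad x ad z ad y\<close>, which agree by cyclicity.\<close>

lemma killing_invariant: "killing (br x y) z = killing x (br y z)"
proof -
  have "trace (\<lambda>w. br y (br x (br z w))) = trace (\<lambda>w. br x (br z (br y w)))"
    by (rule trace_commute[of "br y" "\<lambda>w. br x (br z w)"])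
      (simp_all add: br_linear clinear_iff br_simps)
  then show ?thesis by (simp add: killing_def ad_br br_simps trace_diff)
qed

text \<open>\<open>ad (\<sigma> x)\<close> is the conjugate of \<open>ad x\<close> by
  \<open>\<sigma>\<close>, and conjugation preserves traces.\<close>

lemma killing_automorphism:
  assumes "lie_automorphism br \<sigma>"
  shows "killing (\<sigma> x) (\<sigma> y) = killing x y"
proof -
  have \<sigma>: "clinear \<sigma>" "bij \<sigma>" "\<And>x y. \<sigma> (br x y) = br (\<sigma> x) (\<sigma> y)"
    using assms by (auto simp: lie_automorphism_def)
  define \<tau> where "\<tau> = inv \<sigma>"
  have \<tau>: "\<sigma> (\<tau> z) = z" "\<tau> (\<sigma> z) = z" for z
    using \<sigma>(2) by (simp_all add: \<tau>_def bij_is_surj surj_f_inv_f bij_is_inj)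
  have "clinear \<tau>" unfolding \<tau>_def using \<sigma>(1,2) by (rule clinear_inv)
  have "killing (\<sigma> x) (\<sigma> y) = trace (\<lambda>z. \<sigma> (br x (br y (\<tau> z))))"
    by (simp add: killing_def \<sigma>(3) \<tau>)
  also have "\<dots> = trace (\<lambda>z. br x (br y (\<tau> (\<sigma> z))))"
    by (rule trace_commute[OF \<sigma>(1), of "\<lambda>z. br x (br y (\<tau> z))"])
      (use \<open>clinear \<tau>\<close> in \<open>simp add: clinear_iff br_simps\<close>)
  finally show ?thesis by (simp add: \<tau> killing_def)
qed

text \<open>The argument behind Cartan's criterion.  Complex conjugation of the eigenvalues turns the
  semisimple part of \<open>ad t\<close> into a derivation \<open>S\<close>, and the trace of \<open>S \<circ> ad t\<close> is the sum of
  the \<open>|\<lambda>|\<^sup>2\<close> over the eigenvalues \<open>\<lambda>\<close> of \<open>ad t\<close>.  But if the Killing form vanishes, then so does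
  the trace of \<open>S \<circ> ad [y,z] = S \<circ> [ad y, ad z]\<close>, which equals that of \<open>[S, ad y] \<circ> ad z\<close>.\<close>

lemma killing_nonzero:
  assumes gen: "\<And>b. b \<in> B \<Longrightarrow> b \<in> gen_eigenspace (br t) (ev b)"
    and diag: "\<And>b. b \<in> B \<Longrightarrow> shift_op (br t) (ev b) b \<in> complex_vector.span (B - {b})"
    and perfect: "t \<in> complex_vector.span {br y z | y z. True}"
    and eigen: "br t x = a *\<^sub>c x" "x \<noteq> 0" "a \<noteq> 0"
  shows "\<exists>y z. killing y z \<noteq> 0"
proof (rule ccontr)
  assume "\<not> ?thesis"
  then have killing0: "killing y z = 0" for y z by simp
  note T = br_linear(2)[of t]
  define S where "S x = (\<Sum>b\<in>B. (cnj (ev b) * coord x b) *\<^sub>c b)" for x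
  have S: "clinear S"
    unfolding clinear_iff S_def
    by (simp add: coord_add coord_scale sum.distrib scaleC_add_left complex_vector.scale_sum_right
        scaleC_scaleC algebra_simps)
  have coord_S: "coord (S y) b = cnj (ev b) * coord y b" if "b \<in> B" for y b
    using that finite
    by (simp add: S_def coord_sum coord_scale coord_basis if_distrib cong: if_cong sum.cong)
  have S_eigen: "S y = cnj c *\<^sub>c y" if y: "y \<in> gen_eigenspace (br t) c" for y c
  proof -
    \<comment> \<open>\<open>S\<close> is defined through the basis, so one must show that
      \<open>y\<close> involves only basis vectors with eigenvalue \<open>c\<close>. Grouping the
      expansion by eigenvalue reduces this to independence; \<open>c\<close> is inserted because it
      need not be a value of \<open>ev\<close>.\<close>
    define F where "F = insert c (ev ` B)"
    define Y where "Y e = (\<Sum>b\<in>{b\<in>B. ev b = e}. coord y b *\<^sub>c b)" for e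
    have F: "finite F" "ev ` B \<subseteq> F" "c \<in> F" using finite by (auto simp: F_def)
    note sub = subspace_gen_eigenspace[OF T]
    have "Y e - (if e = c then y else 0) = 0" if "e \<in> F" for e
    proof (rule gen_eigenspaces_independent[OF T F(1) _ _ that])
      fix e
      have "Y e \<in> gen_eigenspace (br t) e"
        unfolding Y_def using gen
        by (intro complex_vector.subspace_sum[OF sub] complex_vector.subspace_scale[OF sub]) auto
      then show "Y e - (if e = c then y else 0) \<in> gen_eigenspace (br t) e"
        using y by (auto intro!: complex_vector.subspace_diff[OF sub])
    next
      have "(\<Sum>e\<in>F. Y e) = y"
        unfolding Y_def sum.group[OF finite F(1,2)] by (rule coord_expand)
      then show "(\<Sum>e\<in>F. Y e - (if e = c then y else 0)) = 0"
        using F by (simp add: sum_subtractf)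
    qed
    then have Y: "Y e = (if e = c then y else 0)" if "e \<in> F" for e using that by force
    have "S y = (\<Sum>e\<in>F. \<Sum>b\<in>{b\<in>B. ev b = e}. (cnj (ev b) * coord y b) *\<^sub>c b)"
      unfolding S_def sum.group[OF finite F(1,2)] ..
    also have "\<dots> = (\<Sum>e\<in>F. cnj e *\<^sub>c Y e)"
      unfolding Y_def complex_vector.scale_sum_right
      by (intro sum.cong) (auto simp: scaleC_scaleC)
    also have "\<dots> = (\<Sum>e\<in>F. if e = c then cnj c *\<^sub>c y else 0)"
      by (intro sum.cong) (auto simp: Y)
    also have "\<dots> = cnj c *\<^sub>c y" using F by simp
    finally show ?thesis .
  qed
  \<comment> \<open>Brackets add eigenvalues and conjugation is additive, so the rule holds on basis
    vectors. It says that the commutator of \<open>S\<close> with \<open>ad y\<close> is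
    \<open>ad (S y)\<close>, which turns the trace below into a value of the Killing form.\<close>
  have S_derivation: "S (br y z) = br (S y) z + br y (S z)" for y z
  proof -
    have 1: "S (br b c) = br (S b) c + br b (S c)" if "b \<in> B" "c \<in> B" for b c
      using S_eigen[OF br_gen_eigenspaces[OF gen gen]] S_eigen[OF gen] that
      by (simp add: br_simps scaleC_add_left)
    have 2: "S (br b z) = br (S b) z + br b (S z)" if b: "b \<in> B" for b z
      by (rule basis_extension[of "\<lambda>z. S (br b z)" "\<lambda>z. br (S b) z + br b (S z)" z])
        (simp_all add: clinear_iff clinear_rules[OF S] br_simps scaleC_add_right add_ac 1 b)
    show ?thesis
      by (rule basis_extension[of "\<lambda>y. S (br y z)" "\<lambda>y. br (S y) z + br y (S z)" y])
        (simp_all add: clinear_iff clinear_rules[OF S] br_simps scaleC_add_right add_ac 2)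
  qed
  have trace_S: "trace (\<lambda>w. S (br v w)) = 0" if "v \<in> complex_vector.span {br y z | y z. True}" for v
    using that
  proof (induction rule: complex_vector.span_induct_alt)
    case base
    show ?case by (simp add: br_simps clinear_zero[OF S] trace_def complex_vector.representation_zero)
  next
    case (step c v u)
    then obtain y z where v: "v = br y z" by blast
    have "trace (\<lambda>w. S (br z (br y w))) = trace (\<lambda>w. br y (S (br z w)))"
      by (rule trace_commute[of "\<lambda>w. S (br z w)" "br y"])
        (simp_all add: br_linear clinear_iff br_simps clinear_rules[OF S])
    then have "trace (\<lambda>w. S (br v w)) = killing (S y) z"
      by (simp add: v ad_br clinear_rules[OF S] trace_diff killing_def S_derivation[of y] trace_add)
    then show ?case
      using step.IH killing0
      by (simp add: br_simps clinear_rules[OF S] trace_add trace_scale)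
  qed
  have "coord (br t b) b = ev b" if b: "b \<in> B" for b
  proof -
    have "coord (shift_op (br t) (ev b) b) b = 0" using coord_span[OF diag[OF b]] by simp
    then show ?thesis using b by (simp add: shift_op_def coord_diff coord_scale coord_basis)
  qed
  then have "trace (\<lambda>w. S (br t w)) = (\<Sum>b\<in>B. cnj (ev b) * ev b)"
    unfolding trace_def by (intro sum.cong) (simp_all add: coord_S)
  also have "\<dots> = of_real (\<Sum>b\<in>B. (cmod (ev b))\<^sup>2)"
    unfolding of_real_sum by (intro sum.cong) (simp_all only: complex_norm_square mult.commute)
  finally have "(\<Sum>b\<in>B. (cmod (ev b))\<^sup>2) = 0" using trace_S[OF perfect] by (metis of_real_eq_0_iff)
  then have "ev b = 0" if "b \<in> B" for b
    using that finite by (simp add: sum_nonneg_eq_0_iff)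
  then have "B \<subseteq> gen_eigenspace (br t) 0" using gen by force
  then have "complex_vector.span B \<subseteq> gen_eigenspace (br t) 0"
    by (rule complex_vector.span_minimal[OF _ subspace_gen_eigenspace[OF T]])
  then have "x \<in> gen_eigenspace (br t) 0" using span by blast
  moreover have "(shift_op (br t) a ^^ 1) x = 0" using eigen(1) by (simp add: shift_op_def)
  then have "x \<in> gen_eigenspace (br t) a" unfolding gen_eigenspace_def by blast
  ultimately show False using gen_eigenspaces_disjoint[OF T] eigen(2,3) by metis
qed

end


section \<open>Invariance of the form\<close>

lemma (in simple_lie_algebra) perfect: "complex_vector.span {br y z | y z. True} = UNIV"
proof -
  have "lie_ideal br (complex_vector.span {br y z | y z. True})"
    unfolding lie_ideal_def by (auto intro: complex_vector.span_base)
  moreover have "complex_vector.span {br y z | y z. True} \<noteq> {0}"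
    using non_abelian by (auto simp: set_eq_iff intro: complex_vector.span_base)
  ultimately show ?thesis using ideals_trivial by blast
qed

context invariant_form
begin

lemmas form_linear = cbilinear_left[OF form_bilinear] cbilinear_right[OF form_bilinear]

lemmas form_simps = clinear_add[OF form_linear(1)] clinear_add[OF form_linear(2)]
  clinear_scale[OF form_linear(1)] clinear_scale[OF form_linear(2)]
  clinear_zero[OF form_linear(1)] clinear_zero[OF form_linear(2)]
  clinear_diff[OF form_linear(1)] clinear_diff[OF form_linear(2)]

lemma form_eqI: "x = y" if "\<And>z. form x z = form y z"
  using form_nondegenerate[of "x - y"] that by (simp add: form_simps)

lemma form_representation:
  fixes B :: "'g set"
  assumes B: "finite_basis B" and f: "clinear f"
  shows "\<exists>y. \<forall>z. form y z = f z"
proof -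
  interpret finite_basis B by (rule B)
  interpret V: finite_dimensional_vector_space "scaleC :: complex \<Rightarrow> 'g \<Rightarrow> 'g" B
    by unfold_locales (rule finite independent span)+
  \<comment> \<open>Nondegeneracy is injectivity of \<open>x \<mapsto> form x\<close>. Storing the
    values on the basis as coordinates makes this an endomorphism, for which injective implies
    surjective.\<close>
  define T where "T x = (\<Sum>b\<in>B. form x b *\<^sub>c b)" for x
  have coord_T: "coord (\<Sum>c\<in>B. h c *\<^sub>c c) b = h b" if "b \<in> B" for h b
    using that finite by (simp add: coord_sum coord_scale coord_basis if_distrib cong: if_cong sum.cong)
  have ext: "form x z = g z" if "clinear g" "\<And>b. b \<in> B \<Longrightarrow> form x b = g b" for x z g
    using basis_extension[OF form_linear(2) that] .
  have "clinear T"
    unfolding clinear_iff T_def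
    by (simp add: form_simps sum.distrib scaleC_add_left complex_vector.scale_sum_right
        scaleC_scaleC scaleC_complex_def)
  moreover have "inj T"
  proof (rule injI)
    fix x y assume "T x = T y"
    then have "form x b = form y b" if "b \<in> B" for b
      using coord_T[OF that] unfolding T_def by metis
    then show "x = y" using ext[OF form_linear(2)] form_eqI by blast
  qed
  ultimately have "surj T" by (rule V.linear_inj_imp_surj)
  then obtain y where "T y = (\<Sum>b\<in>B. f b *\<^sub>c b)" by (metis surjD)
  then have "form y b = f b" if "b \<in> B" for b
    using coord_T[OF that] unfolding T_def by metis
  then show ?thesis using ext[OF f] by blast
qed

text \<open>Schur's lemma for the operator \<open>K\<close> comparing the two forms.\<close>

lemma invariant_form_unique:
  fixes B :: "'g set"
  assumes simple: "simple_lie_algebra br" and B: "finite_basis B"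
    and k: "cbilinear k" "\<And>x y z. k (br x y) z = k x (br y z)"
  shows "\<exists>c. \<forall>x y. k x y = c * form x y"
proof -
  interpret simple_lie_algebra br by (rule simple)
  have "\<forall>x. \<exists>y. \<forall>z. form y z = k x z"
    using form_representation[OF B cbilinear_right[OF k(1)]] by blast
  then obtain K where K: "\<And>x z. form (K x) z = k x z" by metis
  note k_simps = clinear_add[OF cbilinear_left[OF k(1)]] clinear_scale[OF cbilinear_left[OF k(1)]]
  have lin: "clinear K"
    unfolding clinear_iff
  proof (intro conjI allI)
    fix x y c
    show "K (x + y) = K x + K y" by (rule form_eqI) (simp add: form_simps K k_simps)
    show "K (c *\<^sub>c x) = c *\<^sub>c K x" by (rule form_eqI) (simp add: form_simps K k_simps)
  qed
  obtain x0 y0 where "br x0 y0 \<noteq> 0" using non_abelian by blast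
  then obtain c x where x: "x \<noteq> 0" "K x = c *\<^sub>c x"
    using ex_eigenvector[OF lin finite_basis.finite[OF B] finite_basis.span[OF B]] by blast
  define I where "I = {x. K x = c *\<^sub>c x}"
  \<comment> \<open>Invariance of both forms lets \<open>K\<close> pass through the first argument
    of the bracket; antisymmetry carries this to the second, as needed for the eigenspace
    \<open>I\<close> to be an ideal.\<close>
  have K_br: "K (br x y) = br x (K y)" for x y
  proof -
    have "K (br y x) = br (K y) x"
      by (rule form_eqI) (simp add: K k(2) form_invariant)
    then show ?thesis
      using antisymmetric[of x y] antisymmetric[of x "K y"] clinear_diff[OF lin, of 0 "br y x"]
      by (simp add: clinear_zero[OF lin])
  qed
  have "lie_ideal br I"
    unfolding lie_ideal_def complex_vector.subspace_def
    by (auto simp: I_def K_br br_simps clinear_rules[OF lin] scaleC_add_right mult.commute)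
  moreover have "x \<in> I" using x by (simp add: I_def)
  ultimately have "I = UNIV" using ideals_trivial[of I] x(1) by blast
  then have "K x = c *\<^sub>c x" for x unfolding I_def by blast
  then have "k x y = c * form x y" for x y
    using K[of x y] by (simp add: form_simps scaleC_complex_def)
  then show ?thesis by blast
qed

lemma form_automorphism:
  assumes simple: "simple_lie_algebra br"
    and fin: "\<exists>B::'g set. finite B \<and> complex_vector.span B = UNIV"
    and long: "long_roots_normalized br form" and \<sigma>: "lie_automorphism br \<sigma>"
  shows "form (\<sigma> x) (\<sigma> y) = form x y"
proof -
  obtain H where "2 \<in> root_square_lengths br form H"
    using long by (auto simp: long_roots_normalized_def)
  then obtain t \<alpha> where t: "form t t = 2" "is_root br H \<alpha>" "t \<in> H" "\<forall>h\<in>H. form t h = \<alpha> h"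
    by (auto simp: root_square_lengths_def)
  \<comment> \<open>The root takes the value \<open>form t t = 2\<close> at its own representative
    \<open>t\<close>, so its root vector is an eigenvector of \<open>ad t\<close> with nonzero
    eigenvalue.\<close>
  then obtain r where r: "r \<noteq> 0" "br t r = 2 *\<^sub>c r" unfolding is_root_def by metis
  obtain B0 :: "'g set" where B0: "finite B0" "complex_vector.span B0 = UNIV" using fin by blast
  obtain B ev where B: "finite B" "complex_vector.independent B" "complex_vector.span B = UNIV"
    and ev: "\<And>b. b \<in> B \<Longrightarrow> b \<in> gen_eigenspace (br t) (ev b)"
    "\<And>b. b \<in> B \<Longrightarrow> shift_op (br t) (ev b) b \<in> complex_vector.span (B - {b})"
    using ex_triangular_basis[OF br_linear(2)[of t] B0] by metis
  have basis: "finite_basis B" using B by unfold_locales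
  interpret lie_algebra_basis br B by (intro lie_algebra_basis.intro basis lie_algebra_axioms)
  have "\<exists>y z. killing y z \<noteq> 0"
    by (rule killing_nonzero[OF ev _ r(2,1)]) (use simple_lie_algebra.perfect[OF simple] in auto)
  moreover obtain c where c: "\<And>x y. killing x y = c * form x y"
    using invariant_form_unique[OF simple basis cbilinear_killing killing_invariant] by blast
  ultimately have "c \<noteq> 0" by auto
  then show ?thesis using killing_automorphism[OF \<sigma>, of x y] by (simp add: c)
qed

end


section \<open>The grading\<close>

text \<open>Simplicity and the normalization of the form enter only through the last assumption,
  which \<open>form_automorphism\<close> provides.\<close>

locale twisted_setting = invariant_form br form
  for br :: "'g::complex_vector \<Rightarrow> 'g \<Rightarrow> 'g" and form :: "'g \<Rightarrow> 'g \<Rightarrow> complex" +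
  fixes \<sigma> :: "'g \<Rightarrow> 'g" and N :: nat
  assumes automorphism: "lie_automorphism br \<sigma>" and order: "has_order \<sigma> N"
    and form_\<sigma>: "form (\<sigma> x) (\<sigma> y) = form x y"
begin

text \<open>Indexing by all integers lets degrees add under brackets without reduction modulo
  \<open>N\<close>.\<close>

abbreviation graded :: "int \<Rightarrow> 'g set" where
  "graded n \<equiv> eigenspace \<sigma> N (nat (n mod int N))"

definition \<epsilon> :: complex where "\<epsilon> = exp (2 * of_real pi * \<i> / of_nat N)"

lemma \<sigma>_linear: "clinear \<sigma>" and \<sigma>_br: "\<sigma> (br x y) = br (\<sigma> x) (\<sigma> y)" and N_pos: "N > 0"
  and \<sigma>_power: "(\<sigma> ^^ N) x = x"
  using automorphism order by (simp_all add: lie_automorphism_def has_order_def)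

lemma \<epsilon>_nonzero: "\<epsilon> \<noteq> 0"
  by (simp add: \<epsilon>_def)

lemma \<epsilon>_power: "\<epsilon> ^ k = cis (2 * pi * k / N)"
  unfolding \<epsilon>_def by (simp add: exp_of_nat_mult[symmetric] cis_conv_exp mult_ac)

lemma \<epsilon>_N: "\<epsilon> ^ N = 1"
  using N_pos by (simp add: \<epsilon>_power)

lemma \<epsilon>_power_eq_1_iff: "k < N \<Longrightarrow> \<epsilon> ^ k = 1 \<longleftrightarrow> k = 0"
proof
  assume k: "k < N" "\<epsilon> ^ k = 1"
  then have "cis (2 * pi * k / N) = cis (2 * pi * 0 / N)" by (simp add: \<epsilon>_power)
  then show "k = 0"
    using k(1) N_pos bij_betw_roots_unity[OF N_pos] by (auto simp: bij_betw_def inj_on_def)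
qed simp

lemma \<epsilon>_powi_mod: "\<epsilon> powi n = \<epsilon> ^ nat (n mod int N)"
proof -
  have "\<epsilon> powi n = \<epsilon> powi (int N * (n div int N) + int (nat (n mod int N)))"
    using N_pos by simp
  also have "\<dots> = (\<epsilon> powi int N) powi (n div int N) * \<epsilon> powi int (nat (n mod int N))"
    by (simp only: power_int_add[OF disjI1[OF \<epsilon>_nonzero]] power_int_mult)
  also have "\<dots> = \<epsilon> ^ nat (n mod int N)" by (simp only: power_int_of_nat \<epsilon>_N) simp
  finally show ?thesis .
qed

lemma graded_iff: "a \<in> graded n \<longleftrightarrow> \<sigma> a = \<epsilon> powi n *\<^sub>c a"
  unfolding \<epsilon>_powi_mod eigenspace_def by (simp add: \<epsilon>_def)

lemma graded_cong: "m mod int N = n mod int N \<Longrightarrow> graded m = graded n"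
  by simp

lemma br_graded: "a \<in> graded m \<Longrightarrow> b \<in> graded n \<Longrightarrow> br a b \<in> graded (m + n)"
  using \<epsilon>_nonzero by (simp add: graded_iff \<sigma>_br br_simps power_int_add scaleC_scaleC mult.commute)

lemma subspace_graded: "complex_vector.subspace (graded n)"
  by (auto simp: complex_vector.subspace_def graded_iff clinear_rules[OF \<sigma>_linear]
      scaleC_add_right mult.commute)

text \<open>Applying \<open>\<sigma>\<close> to both arguments multiplies the value by
  \<open>\<epsilon> powi (m + n)\<close>, which must therefore be 1.\<close>

lemma form_graded:
  assumes "a \<in> graded m" "b \<in> graded n" "form a b \<noteq> 0"
  shows "(m + n) mod int N = 0"
proof -
  have "form a b = \<epsilon> powi (m + n) * form a b"
    using form_\<sigma>[of a b] assms(1,2) \<epsilon>_nonzero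
    by (simp add: graded_iff form_simps scaleC_complex_def power_int_add mult_ac)
  then have "\<epsilon> ^ nat ((m + n) mod int N) = 1" using assms(3) by (simp add: \<epsilon>_powi_mod)
  moreover have "nat ((m + n) mod int N) < N" using N_pos by (simp add: nat_less_iff)
  ultimately have "nat ((m + n) mod int N) = 0" using \<epsilon>_power_eq_1_iff by blast
  moreover have "(m + n) mod int N \<ge> 0" using N_pos by simp
  ultimately show ?thesis by linarith
qed

lemma graded_decomposition: "\<exists>d. (\<forall>i<N. d i \<in> graded (int i)) \<and> a = (\<Sum>i<N. d i)"
proof -
  \<comment> \<open>\<open>d i\<close> is the projection of \<open>a\<close> to the
    \<open>\<epsilon> ^ i\<close>-eigenspace: the average of
    \<open>\<epsilon>^(-ik) \<sigma>^k a\<close> over the cyclic group generated by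
    \<open>\<sigma>\<close>. Applying \<open>\<sigma>\<close> shifts \<open>k\<close>
    cyclically.\<close>
  define f where "f i k = (1 / \<epsilon> ^ i) ^ k *\<^sub>c (\<sigma> ^^ k) a" for i k
  define d where "d i = (1 / of_nat N) *\<^sub>c (\<Sum>k<N. f i k)" for i
  have step: "\<sigma> (f i k) = \<epsilon> ^ i *\<^sub>c f i (Suc k)" for i k
    using \<epsilon>_nonzero by (simp add: f_def clinear_scale[OF \<sigma>_linear] scaleC_scaleC)
  have "\<sigma> (d i) = \<epsilon> ^ i *\<^sub>c d i" for i
  proof -
    have "(1 / \<epsilon> ^ i) ^ N = 1"
      by (metis \<epsilon>_N power_commutes power_mult mult.commute power_one power_one_over div_by_1)
    then have "f i N = f i 0" by (simp add: f_def \<sigma>_power)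
    then have shift: "(\<Sum>k<N. f i (Suc k)) = (\<Sum>k<N. f i k)"
      using sum.lessThan_Suc_shift[of "f i" N] by (simp add: add.commute)
    have "\<sigma> (d i) = (1 / of_nat N) *\<^sub>c (\<Sum>k<N. \<epsilon> ^ i *\<^sub>c f i (Suc k))"
      by (simp add: d_def clinear_rules[OF \<sigma>_linear] step)
    also have "\<dots> = \<epsilon> ^ i *\<^sub>c d i"
      unfolding complex_vector.scale_sum_right[symmetric] shift d_def
      by (simp add: scaleC_scaleC mult.commute)
    finally show ?thesis .
  qed
  then have "d i \<in> graded (int i)" for i by (simp add: graded_iff)
  moreover have "a = (\<Sum>i<N. d i)"
  proof -
    have geo: "(\<Sum>i<N. (1 / \<epsilon> ^ i) ^ k) = (if k = 0 then of_nat N else 0)" if "k < N" for k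
    proof (cases "k = 0")
      case False
      let ?z = "1 / \<epsilon> ^ k"
      have "?z \<noteq> 1" using \<epsilon>_power_eq_1_iff[OF that] False by simp
      moreover have "?z ^ N = 1"
        by (metis \<epsilon>_N power_mult mult.commute power_one power_one_over div_by_1)
      ultimately have "(\<Sum>i<N. ?z ^ i) = 0" using one_diff_power_eq[of ?z N] by fastforce
      moreover have "(1 / \<epsilon> ^ i) ^ k = ?z ^ i" for i
        by (metis power_mult mult.commute power_one_over)
      ultimately show ?thesis using False by simp
    qed simp
    have "(\<Sum>i<N. d i) = (1 / of_nat N) *\<^sub>c (\<Sum>k<N. (\<Sum>i<N. (1 / \<epsilon> ^ i) ^ k) *\<^sub>c (\<sigma> ^^ k) a)"
      unfolding d_def f_def complex_vector.scale_sum_right[symmetric] complex_vector.scale_sum_left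
      by (subst sum.swap) rule
    also have "(\<Sum>k<N. (\<Sum>i<N. (1 / \<epsilon> ^ i) ^ k) *\<^sub>c (\<sigma> ^^ k) a)
        = (\<Sum>k<N. if k = 0 then of_nat N *\<^sub>c a else 0)"
      by (intro sum.cong) (simp_all add: geo)
    also have "\<dots> = of_nat N *\<^sub>c a" using N_pos by simp
    finally show ?thesis using N_pos by (simp add: scaleC_scaleC scaleC_one)
  qed
  ultimately show ?thesis by blast
qed

text \<open>A nonzero value of the form must occur between homogeneous components, and
  \<open>form_graded\<close> forces their degrees to be opposite modulo \<open>N\<close>.\<close>

lemma ex_pairing:
  assumes "(x::'g) \<noteq> 0"
  shows "\<exists>m a b. a \<in> graded m \<and> b \<in> graded (- m) \<and> form a b \<noteq> 0"
proof -
  obtain y where y: "form x y \<noteq> 0" using form_nondegenerate assms by blast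
  obtain d where d: "\<forall>i<N. d i \<in> graded (int i)" "x = (\<Sum>i<N. d i)"
    using graded_decomposition by blast
  obtain e where e: "\<forall>i<N. e i \<in> graded (int i)" "y = (\<Sum>i<N. e i)"
    using graded_decomposition by blast
  have "(\<Sum>i<N. \<Sum>j<N. form (d i) (e j)) \<noteq> 0"
    using y unfolding d(2) clinear_sum[OF form_linear(1)]
    unfolding e(2) clinear_sum[OF form_linear(2)] .
  then obtain i where i: "i < N" "(\<Sum>j<N. form (d i) (e j)) \<noteq> 0"
    by (meson lessThan_iff sum.neutral)
  then obtain j where j: "j < N" "form (d i) (e j) \<noteq> 0"
    by (meson lessThan_iff sum.neutral)
  have "(int i + int j) mod int N = 0" using form_graded d(1) e(1) i(1) j by blast
  then have "int j mod int N = (- int i) mod int N"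
    by (metis add_diff_cancel_left' diff_0 mod_0 mod_diff_left_eq)
  then have "e j \<in> graded (- int i)" using e(1) j(1) graded_cong by blast
  then show ?thesis using d(1) i(1) j(2) by blast
qed

end


section \<open>Separating restricted modules from modules in \<open>\<E>\<close>\<close>

context twisted_setting
begin

abbreviation affine :: "'g affine set" where
  "affine \<equiv> twisted_affine \<sigma> N"

abbreviation affine_br :: "'g affine \<Rightarrow> 'g affine \<Rightarrow> 'g affine" where
  "affine_br \<equiv> affine_bracket br form N"

lemma subspace_affine: "complex_vector.subspace affine"
  unfolding complex_vector.subspace_def twisted_affine_def
  by (auto simp: lookup_add scaleC_prod_def scaleC_poly_mapping.rep_eq
      complex_vector.subspace_0[OF subspace_graded] complex_vector.subspace_add[OF subspace_graded]
      complex_vector.subspace_scale[OF subspace_graded])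

lemmas affine_intros = complex_vector.subspace_add[OF subspace_affine]
  complex_vector.subspace_scale[OF subspace_affine]
  complex_vector.subspace_sum[OF subspace_affine] complex_vector.subspace_0[OF subspace_affine]

lemma loop_elt_affine: "a \<in> graded n \<Longrightarrow> loop_elt n a \<in> affine"
  by (auto simp: twisted_affine_def loop_elt_def lookup_single when_def
      complex_vector.subspace_0[OF subspace_graded])

lemma central_affine: "(0, c) \<in> affine"
  by (auto simp: twisted_affine_def complex_vector.subspace_0[OF subspace_graded])

lemma loop_elt_shift: "a \<in> graded n \<Longrightarrow> loop_elt (n + int N * k) a \<in> affine"
  using loop_elt_affine[of a "n + int N * k"] by simp

lemma affine_expand:
  assumes "X \<in> affine"
  shows "X = (\<Sum>n\<in>Poly_Mapping.keys (fst X). loop_elt n (Poly_Mapping.lookup (fst X) n)) + (0, snd X)"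
proof -
  let ?l = "Poly_Mapping.lookup (fst X)"
  have "(\<Sum>n\<in>I. loop_elt n (?l n)) = (\<Sum>n\<in>I. Poly_Mapping.single n (?l n), 0)" if "finite I" for I
    using that by (induction I) (simp_all add: loop_elt_def zero_prod_def)
  moreover have "(\<Sum>n\<in>Poly_Mapping.keys (fst X). Poly_Mapping.single n (?l n)) = fst X"
    by (rule poly_mapping_eqI)
      (simp add: lookup_sum lookup_single when_def in_keys_iff cong: if_cong)
  ultimately show ?thesis by (simp add: prod_eq_iff)
qed

text \<open>\<open>loop_poly n a g\<close> is \<open>a \<otimes> t^(n/N) g(t)\<close>.\<close>

definition loop_poly :: "int \<Rightarrow> 'g \<Rightarrow> complex poly \<Rightarrow> 'g affine" where
  "loop_poly n a g = (\<Sum>j\<le>Polynomial.degree g. Polynomial.coeff g j *\<^sub>c loop_elt (n + int N * int j) a)"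

lemma loop_poly_bound:
  assumes "Polynomial.degree g \<le> d"
  shows "loop_poly n a g = (\<Sum>j\<le>d. Polynomial.coeff g j *\<^sub>c loop_elt (n + int N * int j) a)"
  unfolding loop_poly_def
  by (rule sum.mono_neutral_left) (use assms in \<open>auto simp: coeff_eq_0\<close>)

lemma loop_poly_add: "loop_poly n a (g + h) = loop_poly n a g + loop_poly n a h"
proof -
  let ?d = "max (Polynomial.degree g) (Polynomial.degree h)"
  have "Polynomial.degree (g + h) \<le> ?d" by (rule degree_add_le) auto
  then show ?thesis
    by (simp add: loop_poly_bound[of _ ?d] scaleC_add_left sum.distrib)
qed

lemma loop_poly_smult: "loop_poly n a (Polynomial.smult c g) = c *\<^sub>c loop_poly n a g"
  by (simp add: loop_poly_bound[of _ "Polynomial.degree g"] degree_smult_le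
      complex_vector.scale_sum_right scaleC_scaleC)

lemma loop_poly_pCons: "loop_poly n a (pCons c g) = c *\<^sub>c loop_elt n a + loop_poly (n + int N) a g"
proof -
  have "Polynomial.degree (pCons c g) \<le> Suc (Polynomial.degree g)" by (rule degree_pCons_le)
  then show ?thesis
    by (simp add: loop_poly_bound[of "pCons c g"] loop_poly_def sum.atMost_Suc_shift algebra_simps
        del: sum.atMost_Suc)
qed

lemma loop_poly_0 [simp]: "loop_poly n a 0 = 0"
  by (simp add: loop_poly_def)

lemma loop_poly_monom_mult:
  "loop_poly n a (Polynomial.monom 1 M * g) = loop_poly (n + int N * int M) a g"
  by (induction M arbitrary: n)
    (simp_all add: monom_0 monom_Suc loop_poly_pCons algebra_simps)

lemma loop_poly_affine: "a \<in> graded n \<Longrightarrow> loop_poly n a g \<in> affine"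
  unfolding loop_poly_def by (intro affine_intros loop_elt_shift)

text \<open>All integers \<open>n\<close> are allowed, not just representatives modulo
  \<open>N\<close>; closure under division by \<open>t\<close> rests on this.\<close>

definition annihilator :: "('g affine \<Rightarrow> 'u::complex_vector \<Rightarrow> 'u) \<Rightarrow> complex poly set" where
  "annihilator U = {g. \<forall>n a u. a \<in> graded n \<longrightarrow> U (loop_poly n a g) u = 0}"

lemma module_sum:
  assumes U: "lie_module affine affine_br U" and X: "\<And>i. i \<in> I \<Longrightarrow> X i \<in> affine"
  shows "U (\<Sum>i\<in>I. X i) u = (\<Sum>i\<in>I. U (X i) u)"
  using X
proof (induction I rule: infinite_finite_induct)
  case (insert i I)
  then show ?case using lie_module.act_add[OF U] by (simp add: affine_intros)
qed (use lie_module.act_scale[OF U, of 0 0] affine_intros in simp_all)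

lemma module_loop_poly:
  assumes U: "lie_module affine affine_br U" and a: "a \<in> graded n"
  shows "U (loop_poly n a g) u =
    (\<Sum>j\<le>Polynomial.degree g. Polynomial.coeff g j *\<^sub>c U (loop_elt (n + int N * int j) a) u)"
  unfolding loop_poly_def
  by (simp add: module_sum[OF U] affine_intros loop_elt_shift[OF a]
      lie_module.act_scale[OF U loop_elt_shift[OF a]])

lemma gen_series_graded:
  assumes "a \<in> graded n"
  shows "gen_series \<sigma> N \<rho> a w (- n - int N) = \<rho> (loop_elt n a) w"
proof -
  have "nat (n mod int N) < N" using N_pos by (simp add: nat_less_iff)
  then show ?thesis
    using graded_components_eigenspace[OF \<sigma>_linear assms] by (simp add: gen_series_def)
qed

section \<open>Annihilating polynomials and truncation on the two categories\<close>

lemma category_E_module: "category_E br form \<sigma> N U \<Longrightarrow> lie_module affine affine_br U"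
  and category_R_module: "category_R br form \<sigma> N W \<Longrightarrow> lie_module affine affine_br W"
  by (simp_all add: category_E_def category_R_def)

text \<open>The coefficient of \<open>x^(-n/N-1)\<close> in \<open>x^j a(x)\<close> is
  \<open>a \<otimes> t^(n/N+j)\<close>. So the coefficients of \<open>p(x) a(x)\<close> are the
  elements \<open>a \<otimes> t^(n/N) p(t)\<close>.\<close>

lemma category_E_annihilator:
  assumes U: "category_E br form \<sigma> N U"
  shows "\<exists>p. p \<noteq> 0 \<and> p \<in> annihilator U"
proof -
  obtain p where p: "p \<noteq> 0" "\<And>a u k. poly_times_series N p (gen_series \<sigma> N U a u) k = 0"
    using U by (auto simp: category_E_def)
  have "U (loop_poly n a p) u = 0" if a: "a \<in> graded n" for a n u
  proof -
    have "gen_series \<sigma> N U a u (- n - int N - int N * int j) = U (loop_elt (n + int N * int j) a) u" for j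
      using gen_series_graded[of a "n + int N * int j" U u] a by (simp add: algebra_simps)
    then show ?thesis
      using p(2)[of a u "- n - int N"]
      by (simp add: poly_times_series_def module_loop_poly[OF category_E_module[OF U] a])
  qed
  then show ?thesis using p(1) by (auto simp: annihilator_def)
qed

lemma category_R_restricted:
  assumes W: "category_R br form \<sigma> N W" and a: "a \<in> graded n"
  shows "\<exists>M. \<forall>m\<ge>M. W (loop_elt (n + int N * int m) a) w = 0"
proof -
  obtain K where K: "\<And>k. k < K \<Longrightarrow> gen_series \<sigma> N W a w k = 0"
    using W unfolding category_R_def lower_truncated_def by blast
  have "W (loop_elt (n + int N * int m) a) w = 0" if m: "m \<ge> nat (\<bar>K\<bar> + \<bar>n\<bar> + 1)" for m
  proof -
    have "int m \<le> int N * int m" using N_pos mult_right_mono[of 1 "int N" "int m"] by simp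
    then have "- (n + int N * int m) - int N < K" using m by linarith
    then show ?thesis
      using K gen_series_graded[of a "n + int N * int m" W w] a by simp
  qed
  then show ?thesis by blast
qed

lemma category_R_restricted_finite:
  assumes W: "category_R br form \<sigma> N W" and a: "a \<in> graded n" and "finite F"
  shows "\<exists>M. \<forall>m\<ge>M. \<forall>w\<in>F. W (loop_elt (n + int N * int m) a) w = 0"
  using \<open>finite F\<close>
proof induction
  case (insert w F)
  then obtain M where "\<forall>m\<ge>M. \<forall>w\<in>F. W (loop_elt (n + int N * int m) a) w = 0" by blast
  moreover obtain M' where "\<forall>m\<ge>M'. W (loop_elt (n + int N * int m) a) w = 0"
    using category_R_restricted[OF W a] by blast
  ultimately show ?case by (intro exI[of _ "max M M'"]) auto
qed simp

lemma annihilator_add: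
  assumes U: "lie_module affine affine_br U" and "g \<in> annihilator U" "h \<in> annihilator U"
  shows "g + h \<in> annihilator U"
  using assms(2,3)
  by (simp add: annihilator_def loop_poly_add lie_module.act_add[OF U] loop_poly_affine)

lemma annihilator_smult:
  assumes U: "lie_module affine affine_br U" and "g \<in> annihilator U"
  shows "Polynomial.smult c g \<in> annihilator U"
  using assms(2)
  by (simp add: annihilator_def loop_poly_smult lie_module.act_scale[OF U] loop_poly_affine)

text \<open>The factor \<open>t\<close> is absorbed by replacing \<open>n\<close> with
  \<open>n + N\<close>, or undone with \<open>n - N\<close>; the degree modulo \<open>N\<close> is
  unchanged.\<close>

lemma annihilator_pCons_0: "pCons 0 g \<in> annihilator U \<longleftrightarrow> g \<in> annihilator U"
proof
  assume g: "pCons 0 g \<in> annihilator U"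
  have "U (loop_poly n a g) u = 0" if "a \<in> graded n" for n a u
    using g that unfolding annihilator_def
    by (auto simp: loop_poly_pCons dest!: spec[of _ "n - int N"])
  then show "g \<in> annihilator U" by (auto simp: annihilator_def)
next
  assume "g \<in> annihilator U"
  then show "pCons 0 g \<in> annihilator U" by (auto simp: annihilator_def loop_poly_pCons)
qed

lemma annihilator_mult:
  assumes U: "lie_module affine affine_br U" and "g \<in> annihilator U"
  shows "h * g \<in> annihilator U"
proof (induction h)
  case 0
  then show ?case using annihilator_smult[OF assms, of 0] by simp
next
  case (pCons c h)
  then show ?case
    using annihilator_add[OF U annihilator_smult[OF assms]] annihilator_pCons_0[of "h * g" U] by simp
qed

text \<open>The element \<open>a \<otimes> t^(m/N) p(t)\<close> acts as zero, hence so does its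
  bracket with \<open>b \<otimes> t^(n/N)\<close>. The loop part of the bracket is again a multiple
  of \<open>p(t)\<close> and acts as zero, which leaves a central term.\<close>

lemma central_acts_trivially:
  assumes U: "category_E br form \<sigma> N U" and x: "(x :: 'g) \<noteq> 0"
  shows "U (0, c) u = 0"
proof -
  interpret U: lie_module affine affine_br U using category_E_module[OF U] .
  obtain p where p: "p \<noteq> 0" "p \<in> annihilator U" using category_E_annihilator[OF U] by blast
  obtain j where j: "Polynomial.coeff p j \<noteq> 0" "j \<le> Polynomial.degree p"
    using p(1) leading_coeff_0_iff by blast
  obtain i a b where ab: "a \<in> graded i" "b \<in> graded (- i)" "form a b \<noteq> 0"
    using ex_pairing[OF x] by blast
  \<comment> \<open>The central term will carry the factor \<open>(m + N j) / N\<close>. If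
    \<open>i + N j\<close> vanishes, raising \<open>i\<close> by \<open>N\<close> makes the factor 1
    without changing the grading.\<close>
  define m where "m = (if i + int N * int j = 0 then i + int N else i)"
  \<comment> \<open>With this \<open>n\<close>, only the \<open>j\<close>-th coefficient of
    \<open>p\<close> contributes to the central term.\<close>
  define n where "n = - m - int N * int j"
  have a: "a \<in> graded m" using ab(1) by (simp add: m_def)
  have "n = - i + int N * (- int j - (if i + int N * int j = 0 then 1 else 0))"
    by (simp add: n_def m_def algebra_simps)
  then have "n mod int N = (- i) mod int N" by (metis mod_mult_self2)
  then have b: "b \<in> graded n" using ab(2) graded_cong by blast
  have nz: "m + int N * int j \<noteq> 0" using N_pos by (simp add: m_def)
  define A where "A k = loop_elt (m + int N * int k) a" for k
  define B where "B = loop_elt n b"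
  note A = loop_elt_shift[OF a, of "int k" for k, folded A_def]
  have B: "B \<in> affine" unfolding B_def by (rule loop_elt_affine[OF b])
  let ?e = "\<lambda>k. if k = j then of_int (m + int N * int j) / of_nat N * form a b else 0"
  have br: "affine_br (A k) B = loop_elt (m + n + int N * int k) (br a b) + (0, ?e k)" for k
    unfolding A_def B_def affine_bracket_loop[OF bilinear form_bilinear]
    using N_pos by (auto simp: loop_elt_def n_def algebra_simps)
  have ab': "br a b \<in> graded (m + n)" using br_graded[OF a b] .
  have p0: "(\<Sum>k\<le>Polynomial.degree p. Polynomial.coeff p k *\<^sub>c U (A k) v) = 0" for v
    using p(2) a unfolding A_def annihilator_def module_loop_poly[OF U.lie_module_axioms a, symmetric]
    by blast
  have p0': "(\<Sum>k\<le>Polynomial.degree p. Polynomial.coeff p k *\<^sub>c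
      U (loop_elt (m + n + int N * int k) (br a b)) v) = 0" for v
    using p(2) ab' unfolding annihilator_def module_loop_poly[OF U.lie_module_axioms ab', symmetric]
    by blast
  have "0 = (\<Sum>k\<le>Polynomial.degree p. Polynomial.coeff p k *\<^sub>c U (A k) (U B u))
      - U B (\<Sum>k\<le>Polynomial.degree p. Polynomial.coeff p k *\<^sub>c U (A k) u)"
    by (simp add: p0 clinear_zero[OF U.act_linear[OF B]])
  also have "\<dots> = (\<Sum>k\<le>Polynomial.degree p. Polynomial.coeff p k *\<^sub>c U (affine_br (A k) B) u)"
    by (simp add: clinear_rules[OF U.act_linear[OF B]] U.act_bracket[OF A B] sum_subtractf
        complex_vector.scale_right_diff_distrib)
  also have "\<dots> = (\<Sum>k\<le>Polynomial.degree p. Polynomial.coeff p k *\<^sub>c U (0, ?e k) u)"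
    by (simp only: br U.act_add[OF loop_elt_shift[OF ab'] central_affine] scaleC_add_right
        sum.distrib p0' add_0)
  also have "\<dots> = (\<Sum>k\<le>Polynomial.degree p. if k = j then Polynomial.coeff p j *\<^sub>c U (0, ?e j) u else 0)"
    using U.act_scale[OF central_affine, of 0 0] by (intro sum.cong) (auto simp: scaleC_prod_def)
  also have "\<dots> = Polynomial.coeff p j *\<^sub>c U (0, ?e j) u" using j(2) by simp
  finally have 0: "U (0, ?e j) u = 0" using j(1) by simp
  have ne: "?e j \<noteq> 0"
    using nz ab(3) N_pos of_int_eq_0_iff[of "m + int N * int j", where 'a = complex] by simp
  then have "(0, c) = (c / ?e j) *\<^sub>c (0 :: int \<Rightarrow>\<^sub>0 'g, ?e j)"
    by (simp add: scaleC_prod_def scaleC_complex_def)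
  then have "U (0, c) u = (c / ?e j) *\<^sub>c U (0, ?e j) u"
    using U.act_scale[OF central_affine] by metis
  then show ?thesis using 0 by simp
qed

lemma ex_common_annihilator:
  assumes U1: "category_E br form \<sigma> N U1" and U2: "category_E br form \<sigma> N U2"
  shows "\<exists>h. 1 + Polynomial.monom 1 M * h \<in> annihilator U1 \<inter> annihilator U2"
proof -
  let ?Z = "annihilator U1 \<inter> annihilator U2"
  note U = category_E_module[OF U1] category_E_module[OF U2]
  obtain p1 p2 where p: "p1 \<noteq> 0" "p1 \<in> annihilator U1" "p2 \<noteq> 0" "p2 \<in> annihilator U2"
    using category_E_annihilator U1 U2 by metis
  then have "p1 * p2 \<in> ?Z"
    using annihilator_mult[OF U(1), of p1 p2] annihilator_mult[OF U(2), of p2 p1]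
    by (simp add: mult.commute)
  moreover have "p1 * p2 \<noteq> 0" using p by simp
  ultimately obtain p where "p \<noteq> 0" "p \<in> ?Z" by metis
  \<comment> \<open>Strip factors of \<open>t\<close> from \<open>p\<close>; each division stays in
    both annihilators.\<close>
  then have "\<exists>q\<in>?Z. Polynomial.coeff q 0 \<noteq> 0"
  proof (induction p)
    case (pCons c p)
    show ?case
    proof (cases "c = 0")
      case True
      then show ?thesis
        using pCons annihilator_pCons_0[of p U1] annihilator_pCons_0[of p U2] by fast
    next
      case False
      then show ?thesis using pCons.prems by (intro bexI[of _ "pCons c p"]) auto
    qed
  qed simp
  then obtain q0 where q0: "q0 \<in> ?Z" "Polynomial.coeff q0 0 \<noteq> 0" by blast
  define q where "q = Polynomial.smult (1 / Polynomial.coeff q0 0) q0"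
  have q: "q \<in> ?Z" "Polynomial.coeff q 0 = 1"
    using q0 annihilator_smult[OF U(1)] annihilator_smult[OF U(2)] by (auto simp: q_def)
  show ?thesis
  proof (induction M)
    case 0
    then show ?case using q(1) by (intro exI[of _ "q - 1"]) (simp add: monom_0)
  next
    case (Suc M)
    then obtain h where h: "1 + Polynomial.monom 1 M * h \<in> ?Z" by blast
    let ?c = "Polynomial.coeff h 0"
    \<comment> \<open>Subtracting \<open>?c t^M q\<close> cancels the coefficient of
      \<open>t^M\<close>, because \<open>q\<close> has constant term 1, and stays in the
      ideal.\<close>
    have "Polynomial.coeff (h - Polynomial.smult ?c q) 0 = 0" using q(2) by simp
    then obtain h' where h': "h - Polynomial.smult ?c q = pCons 0 h'"
      by (metis coeff_pCons_0 pCons_cases)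
    have monom_c: "Polynomial.monom (- ?c) M = Polynomial.smult (- ?c) (Polynomial.monom 1 M)"
      by (simp only: smult_monom mult_1_right)
    have "(1 + Polynomial.monom 1 M * h) + Polynomial.monom (- ?c) M * q
        = 1 + Polynomial.monom 1 M * (h - Polynomial.smult ?c q)"
      unfolding monom_c by (simp add: algebra_simps)
    also have "\<dots> = 1 + Polynomial.monom 1 (Suc M) * h'"
      unfolding h' by (simp add: monom_Suc)
    finally have "1 + Polynomial.monom 1 (Suc M) * h' =
      (1 + Polynomial.monom 1 M * h) + Polynomial.monom (- ?c) M * q" by simp
    also have "\<dots> \<in> ?Z"
      using h q(1) annihilator_add[OF U(1)] annihilator_add[OF U(2)]
        annihilator_mult[OF U(1)] annihilator_mult[OF U(2)] by blast
    finally show ?case by blast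
  qed
qed

text \<open>The part \<open>t^M h(t)\<close> contributes only elements
  \<open>a \<otimes> t^(n/N+m)\<close> with \<open>m \<ge> M\<close>, and these kill
  \<open>w\<close>.\<close>

lemma module_loop_poly_restricted:
  assumes W: "lie_module affine affine_br W" and a: "a \<in> graded n"
    and w: "\<And>m. m \<ge> M \<Longrightarrow> W (loop_elt (n + int N * int m) a) w = 0"
  shows "W (loop_poly n a (1 + Polynomial.monom 1 M * h)) w = W (loop_elt n a) w"
proof -
  have a': "a \<in> graded (n + int N * int M)" using a by simp
  have "loop_poly n a 1 = loop_elt n a"
    using loop_poly_pCons[of n a 1 0] by (simp add: one_pCons scaleC_one)
  then have "loop_poly n a (1 + Polynomial.monom 1 M * h) = loop_elt n a + loop_poly (n + int N * int M) a h"
    by (simp add: loop_poly_add loop_poly_monom_mult)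
  moreover have "W (loop_elt (n + int N * int M + int N * int j) a) w = 0" for j
    using w[of "M + j"] by (simp add: algebra_simps)
  ultimately show ?thesis
    by (simp add: lie_module.act_add[OF W loop_elt_affine[OF a] loop_poly_affine[OF a']]
        module_loop_poly[OF W a'])
qed

text \<open>The conditions on \<open>Y\<close> are additive in the pair of \<open>X\<close> and
  \<open>Y\<close>, so loop elements and central elements can be treated separately. For a loop
  element, one polynomial serves both modules in category E, and one \<open>M\<close> all vectors of
  \<open>F1\<close> and \<open>F2\<close>.\<close>

lemma separation:
  assumes U1: "category_E br form \<sigma> N U1" and U2: "category_E br form \<sigma> N U2"
    and W1: "category_R br form \<sigma> N W1" and W2: "category_R br form \<sigma> N W2"
    and x: "(x :: 'g) \<noteq> 0" and X: "X \<in> affine" and F: "finite F1" "finite F2"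
  shows "\<exists>Y\<in>affine. (\<forall>u. U1 Y u = 0) \<and> (\<forall>u. U2 Y u = 0) \<and>
    (\<forall>w\<in>F1. W1 Y w = W1 X w) \<and> (\<forall>w\<in>F2. W2 Y w = W2 X w)"
proof -
  note U = category_E_module[OF U1] category_E_module[OF U2]
  note W = category_R_module[OF W1] category_R_module[OF W2]
  define P where "P X Y \<longleftrightarrow> Y \<in> affine \<and> (\<forall>u. U1 Y u = 0) \<and> (\<forall>u. U2 Y u = 0) \<and>
    (\<forall>w\<in>F1. W1 Y w = W1 X w) \<and> (\<forall>w\<in>F2. W2 Y w = W2 X w)" for X Y
  have add: "P (X + X') (Y + Y')" if "P X Y" "P X' Y'" "X \<in> affine" "X' \<in> affine" for X X' Y Y'
    using that U W by (simp add: P_def lie_module.act_add affine_intros)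
  have loop: "\<exists>Y. P (loop_elt n a) Y" if a: "a \<in> graded n" for n a
  proof -
    obtain M1 M2 where M: "\<forall>m\<ge>M1. \<forall>w\<in>F1. W1 (loop_elt (n + int N * int m) a) w = 0"
      "\<forall>m\<ge>M2. \<forall>w\<in>F2. W2 (loop_elt (n + int N * int m) a) w = 0"
      using category_R_restricted_finite[OF W1 a F(1)] category_R_restricted_finite[OF W2 a F(2)]
      by blast
    define M where "M = max M1 M2"
    obtain h where h: "1 + Polynomial.monom 1 M * h \<in> annihilator U1 \<inter> annihilator U2"
      using ex_common_annihilator[OF U1 U2] by blast
    let ?Y = "loop_poly n a (1 + Polynomial.monom 1 M * h)"
    have "P (loop_elt n a) ?Y"
      unfolding P_def
    proof (intro conjI allI ballI)
      show "?Y \<in> affine" by (rule loop_poly_affine[OF a])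
      show "U1 ?Y u = 0" "U2 ?Y v = 0" for u v using h a by (auto simp: annihilator_def)
      show "W1 ?Y w = W1 (loop_elt n a) w" if "w \<in> F1" for w
        using M(1) that by (intro module_loop_poly_restricted[OF W(1) a]) (simp add: M_def)
      show "W2 ?Y w = W2 (loop_elt n a) w" if "w \<in> F2" for w
        using M(2) that by (intro module_loop_poly_restricted[OF W(2) a]) (simp add: M_def)
    qed
    then show ?thesis by blast
  qed
  have a: "Poly_Mapping.lookup (fst X) n \<in> graded n" for n using X by (auto simp: twisted_affine_def)
  \<comment> \<open>The induction starts from the central part, which is its own replacement since
    it acts as zero on \<open>U1\<close> and \<open>U2\<close>.\<close>
  have "\<exists>Y. P ((\<Sum>n\<in>I. loop_elt n (Poly_Mapping.lookup (fst X) n)) + (0, snd X)) Y" if "finite I" for I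
    using that
  proof induction
    case empty
    have "P (0, snd X) (0, snd X)"
      using central_acts_trivially[OF U1 x] central_acts_trivially[OF U2 x]
      by (simp add: P_def central_affine)
    then show ?case by auto
  next
    case (insert n I)
    then obtain Y Y' where "P (loop_elt n (Poly_Mapping.lookup (fst X) n)) Y"
      "P ((\<Sum>n\<in>I. loop_elt n (Poly_Mapping.lookup (fst X) n)) + (0, snd X)) Y'"
      using loop[OF a] by blast
    moreover have "(\<Sum>n\<in>I. loop_elt n (Poly_Mapping.lookup (fst X) n)) + (0, snd X) \<in> affine"
      by (intro affine_intros central_affine loop_elt_affine a)
    ultimately have "P (loop_elt n (Poly_Mapping.lookup (fst X) n) +
        ((\<Sum>n\<in>I. loop_elt n (Poly_Mapping.lookup (fst X) n)) + (0, snd X))) (Y + Y')"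
      using add loop_elt_affine[OF a] by blast
    then show ?case unfolding sum.insert[OF insert.hyps] add.assoc by blast
  qed
  then obtain Y where "P X Y" using affine_expand[OF X] finite_keys by metis
  then show ?thesis unfolding P_def by blast
qed

end


section \<open>Tensor products\<close>

lemmas pure_tensor_linear = cbilinear_left[OF cbilinear_pure_tensor]
  cbilinear_right[OF cbilinear_pure_tensor]

lemmas pure_tensor_simps = clinear_add[OF pure_tensor_linear(1)] clinear_add[OF pure_tensor_linear(2)]
  clinear_scale[OF pure_tensor_linear(1)] clinear_scale[OF pure_tensor_linear(2)]
  clinear_zero[OF pure_tensor_linear(1)] clinear_zero[OF pure_tensor_linear(2)]

lemma tensor_ext:
  assumes "clinear f" "clinear g" "\<And>w u. f (w \<otimes>\<^sub>c u) = g (w \<otimes>\<^sub>c u)"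
  shows "f z = g z"
proof (rule clinear_eq_on_span[OF assms(1,2)])
  show "z \<in> complex_vector.span (range (\<lambda>(w, u). w \<otimes>\<^sub>c u))" by (simp add: span_pure_tensors)
qed (use assms(3) in auto)

lemma tensor_induct [case_names zero step]:
  assumes "P 0" "\<And>c w u z. P z \<Longrightarrow> P (c *\<^sub>c (w \<otimes>\<^sub>c u) + z)"
  shows "P z"
proof -
  have "z \<in> complex_vector.span (range (\<lambda>(w, u). w \<otimes>\<^sub>c u))" by (simp add: span_pure_tensors)
  then show ?thesis
    by (induction rule: complex_vector.span_induct_alt) (use assms in auto)
qed

lemma clinear_compose: "clinear f \<Longrightarrow> clinear g \<Longrightarrow> clinear (\<lambda>x. f (g x))"
  by (simp add: clinear_iff)

definition tensor_map ::
    "('a::complex_vector \<Rightarrow> 'c::complex_vector) \<Rightarrow> ('b::complex_vector \<Rightarrow> 'd::complex_vector) \<Rightarrow>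
     ('a, 'b) tensor \<Rightarrow> ('c, 'd) tensor" where
  "tensor_map f g = tensor_lift (\<lambda>w u. f w \<otimes>\<^sub>c g u)"

lemma clinear_tensor_map: "clinear (tensor_map f g)"
  unfolding tensor_map_def by (rule clinear_tensor_lift)

lemma tensor_map_pure:
  assumes "clinear f" "clinear g"
  shows "tensor_map f g (w \<otimes>\<^sub>c u) = f w \<otimes>\<^sub>c g u"
  unfolding tensor_map_def
  by (rule tensor_lift_pure)
    (simp add: cbilinear_def clinear_iff pure_tensor_simps clinear_rules[OF assms(1)]
      clinear_rules[OF assms(2)])

section \<open>Contraction of one tensor factor with a linear functional\<close>

definition slice_right :: "('b::complex_vector \<Rightarrow> complex) \<Rightarrow> ('a::complex_vector, 'b) tensor \<Rightarrow> 'a" where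
  "slice_right f = tensor_lift (\<lambda>w u. f u *\<^sub>c w)"

definition slice_left :: "('a::complex_vector \<Rightarrow> complex) \<Rightarrow> ('a, 'b::complex_vector) tensor \<Rightarrow> 'b" where
  "slice_left f = tensor_lift (\<lambda>w u. f w *\<^sub>c u)"

lemma clinear_slice: "clinear (slice_right f)" "clinear (slice_left g)"
  unfolding slice_right_def slice_left_def by (rule clinear_tensor_lift)+

lemma slice_right_pure:
  assumes "clinear f"
  shows "slice_right f (w \<otimes>\<^sub>c u) = f u *\<^sub>c w"
  unfolding slice_right_def
  by (rule tensor_lift_pure)
    (simp add: cbilinear_def clinear_iff clinear_rules[OF assms] scaleC_add_left
      scaleC_add_right scaleC_scaleC scaleC_complex_def mult.commute)

lemma slice_left_pure:
  assumes "clinear f"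
  shows "slice_left f (w \<otimes>\<^sub>c u) = f w *\<^sub>c u"
  unfolding slice_left_def
  by (rule tensor_lift_pure)
    (simp add: cbilinear_def clinear_iff clinear_rules[OF assms] scaleC_add_left
      scaleC_add_right scaleC_scaleC scaleC_complex_def mult.commute)

text \<open>Expand the second factor in a basis: the coefficients of \<open>z\<close> are its slices
  by the coordinate functionals, so they cannot all vanish.\<close>

lemma ex_slice_right:
  fixes z :: "('a::complex_vector, 'b::complex_vector) tensor"
  assumes "z \<noteq> 0"
  shows "\<exists>f. clinear f \<and> slice_right f z \<noteq> 0"
proof -
  obtain B :: "'b set" where B: "complex_vector.independent B" "complex_vector.span B = UNIV"
    using complex_vector.maximal_independent_subset[of "UNIV :: 'b set"] by (metis top.extremum_uniqueI)
  let ?r = "complex_vector.representation B"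
  have lin: "clinear (\<lambda>u. ?r u b)" for b
    unfolding clinear_iff using B
    by (simp add: complex_vector.representation_add complex_vector.representation_scale
        scaleC_complex_def)
  \<comment> \<open>The basis may be infinite. Allowing every finite superset \<open>F'\<close>
    gives the summands of \<open>z\<close> a common index set in the induction.\<close>
  have "\<exists>F. finite F \<and> (\<forall>F'. finite F' \<and> F \<subseteq> F' \<longrightarrow>
      z = (\<Sum>b\<in>F'. slice_right (\<lambda>u. ?r u b) z \<otimes>\<^sub>c b))"
  proof (induction z rule: tensor_induct)
    case zero
    show ?case
      by (intro exI[of _ "{}"]) (simp add: clinear_zero[OF clinear_slice(1)] pure_tensor_simps)
  next
    case (step c w u z)
    then obtain F where F: "finite F" "\<And>F'. finite F' \<Longrightarrow> F \<subseteq> F' \<Longrightarrow>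
        z = (\<Sum>b\<in>F'. slice_right (\<lambda>u. ?r u b) z \<otimes>\<^sub>c b)" by blast
    let ?G = "{b. ?r u b \<noteq> 0}"
    have "c *\<^sub>c (w \<otimes>\<^sub>c u) + z = (\<Sum>b\<in>F'. slice_right (\<lambda>u. ?r u b) (c *\<^sub>c (w \<otimes>\<^sub>c u) + z) \<otimes>\<^sub>c b)"
      if F': "finite F'" "F \<union> ?G \<subseteq> F'" for F'
    proof -
      have "(\<Sum>b\<in>F'. ?r u b *\<^sub>c b) = (\<Sum>b\<in>?G. ?r u b *\<^sub>c b)"
        using F' by (intro sum.mono_neutral_right) auto
      also have "\<dots> = u"
        using B by (intro complex_vector.sum_nonzero_representation_eq) auto
      finally have "w \<otimes>\<^sub>c u = w \<otimes>\<^sub>c (\<Sum>b\<in>F'. ?r u b *\<^sub>c b)" by simp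
      also have "\<dots> = (\<Sum>b\<in>F'. (?r u b *\<^sub>c w) \<otimes>\<^sub>c b)"
        by (simp add: clinear_sum[OF pure_tensor_linear(2)] pure_tensor_simps)
      finally have wu: "w \<otimes>\<^sub>c u = (\<Sum>b\<in>F'. (?r u b *\<^sub>c w) \<otimes>\<^sub>c b)" .
      have "(\<Sum>b\<in>F'. slice_right (\<lambda>u. ?r u b) (c *\<^sub>c (w \<otimes>\<^sub>c u) + z) \<otimes>\<^sub>c b)
          = c *\<^sub>c (\<Sum>b\<in>F'. (?r u b *\<^sub>c w) \<otimes>\<^sub>c b) + (\<Sum>b\<in>F'. slice_right (\<lambda>u. ?r u b) z \<otimes>\<^sub>c b)"
        by (simp add: clinear_rules[OF clinear_slice(1)] slice_right_pure[OF lin] pure_tensor_simps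
            sum.distrib complex_vector.scale_sum_right)
      then show ?thesis using wu F(2)[of F'] F' by simp
    qed
    moreover have "finite (F \<union> ?G)" using F(1) by (simp add: complex_vector.finite_representation)
    ultimately show ?case by blast
  qed
  then have "\<exists>b. slice_right (\<lambda>u. ?r u b) z \<noteq> 0"
    using assms by (metis (no_types, lifting) pure_tensor_simps(5) subset_refl sum.neutral)
  then show ?thesis using lin by blast
qed

lemma ex_slice_left:
  fixes z :: "('a::complex_vector, 'b::complex_vector) tensor"
  assumes "z \<noteq> 0"
  shows "\<exists>f. clinear f \<and> slice_left f z \<noteq> 0"
proof -
  define swap :: "('a, 'b) tensor \<Rightarrow> ('b, 'a) tensor" where "swap = tensor_lift (\<lambda>w u. u \<otimes>\<^sub>c w)"
  define swap' :: "('b, 'a) tensor \<Rightarrow> ('a, 'b) tensor" where "swap' = tensor_lift (\<lambda>w u. u \<otimes>\<^sub>c w)"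
  have lin: "clinear swap" "clinear swap'" unfolding swap_def swap'_def by (rule clinear_tensor_lift)+
  have swap: "swap (w \<otimes>\<^sub>c u) = u \<otimes>\<^sub>c w" "swap' (u \<otimes>\<^sub>c w) = w \<otimes>\<^sub>c u" for w u
    unfolding swap_def swap'_def
    by (simp_all add: tensor_lift_pure cbilinear_def clinear_iff pure_tensor_simps)
  have "swap' (swap z) = z"
    by (rule tensor_ext[of "\<lambda>z. swap' (swap z)" "\<lambda>z. z"])
      (simp_all add: clinear_compose lin swap, simp add: clinear_iff)
  then have "swap z \<noteq> 0" using assms clinear_zero[OF lin(2)] by metis
  then obtain f where f: "clinear f" "slice_right f (swap z) \<noteq> 0" using ex_slice_right by blast
  have "slice_right f (swap z) = slice_left f z"
    by (rule tensor_ext[of "\<lambda>z. slice_right f (swap z)" "slice_left f"])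
      (simp_all add: clinear_compose lin clinear_slice swap slice_right_pure slice_left_pure f(1))
  then show ?thesis using f by auto
qed

text \<open>Contracting with a functional that is 1 at \<open>u\<close> recovers
  \<open>w\<close>.\<close>

lemma pure_tensor_nonzero:
  fixes w :: "'a::complex_vector" and u :: "'b::complex_vector"
  assumes "w \<noteq> 0" "u \<noteq> 0"
  shows "w \<otimes>\<^sub>c u \<noteq> 0"
proof
  assume 0: "w \<otimes>\<^sub>c u = 0"
  have "complex_vector.independent {u}" using assms(2) by simp
  then obtain B where B: "u \<in> B" "complex_vector.independent B" "complex_vector.span B = UNIV"
    using complex_vector.maximal_independent_subset_extend[of "{u}" UNIV]
    by (metis insert_subset top.extremum_uniqueI subset_UNIV)
  let ?f = "\<lambda>v. complex_vector.representation B v u"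
  have "clinear ?f"
    unfolding clinear_iff using B
    by (simp add: complex_vector.representation_add complex_vector.representation_scale
        scaleC_complex_def)
  then have "slice_right ?f (w \<otimes>\<^sub>c u) = w"
    using B by (simp add: slice_right_pure complex_vector.representation_basis scaleC_one)
  then show False using 0 assms(1) clinear_zero[OF clinear_slice(1)] by metis
qed

lemma tensor_module_eq:
  assumes "clinear (\<rho> x)" "clinear (\<tau> x)"
  shows "tensor_module \<rho> \<tau> x z = tensor_map (\<rho> x) (\<lambda>u. u) z + tensor_map (\<lambda>w. w) (\<tau> x) z"
proof (rule tensor_ext[of "tensor_module \<rho> \<tau> x"])
  have id: "clinear (\<lambda>u. u)" by (simp add: clinear_iff)
  show "clinear (tensor_module \<rho> \<tau> x)" unfolding tensor_module_def by (rule clinear_tensor_lift)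
  show "clinear (\<lambda>z. tensor_map (\<rho> x) (\<lambda>u. u) z + tensor_map (\<lambda>w. w) (\<tau> x) z)"
    by (simp add: clinear_iff clinear_rules[OF clinear_tensor_map] scaleC_add_right add_ac)
  show "tensor_module \<rho> \<tau> x (w \<otimes>\<^sub>c u) =
      tensor_map (\<rho> x) (\<lambda>u. u) (w \<otimes>\<^sub>c u) + tensor_map (\<lambda>w. w) (\<tau> x) (w \<otimes>\<^sub>c u)" for w u
    using assms by (simp add: tensor_module_pure tensor_map_pure[OF _ id] tensor_map_pure[OF id])
qed

text \<open>\<open>F\<close> consists of the first components in one expression of \<open>z\<close>
  by pure tensors. Agreement on finitely many vectors thereby becomes equality at the tensor
  \<open>z\<close>.\<close>

lemma tensor_finite_support:
  fixes z :: "('a::complex_vector, 'b::complex_vector) tensor"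
  shows "\<exists>F. finite F \<and> (\<forall>f g :: 'a \<Rightarrow> 'c::complex_vector. clinear f \<and> clinear g \<and> (\<forall>w\<in>F. f w = g w) \<longrightarrow>
     tensor_map f (\<lambda>u. u) z = tensor_map g (\<lambda>u. u) z)"
proof (induction z rule: tensor_induct)
  case zero
  show ?case by (intro exI[of _ "{}"]) (simp add: clinear_zero[OF clinear_tensor_map])
next
  case (step c w u z)
  then obtain F where "finite F" "\<And>f g :: 'a \<Rightarrow> 'c. clinear f \<Longrightarrow> clinear g \<Longrightarrow> \<forall>w\<in>F. f w = g w \<Longrightarrow>
     tensor_map f (\<lambda>u. u) z = tensor_map g (\<lambda>u. u) z" by blast
  moreover have "clinear (\<lambda>u :: 'b. u)" by (simp add: clinear_iff)
  ultimately show ?case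
    by (intro exI[of _ "insert w F"]) (simp add: clinear_rules[OF clinear_tensor_map] tensor_map_pure)
qed


section \<open>Homomorphisms\<close>

lemma irreducible_hom_isomorphic:
  fixes \<rho> :: "'l \<Rightarrow> 'w::complex_vector \<Rightarrow> 'w" and \<tau> :: "'l \<Rightarrow> 'v::complex_vector \<Rightarrow> 'v"
  assumes irr: "irreducible_module L \<rho>" "irreducible_module L \<tau>"
    and lin: "\<And>x. x \<in> L \<Longrightarrow> clinear (\<tau> x)"
    and \<psi>: "clinear \<psi>" "\<And>x w. x \<in> L \<Longrightarrow> \<psi> (\<rho> x w) = \<tau> x (\<psi> w)" "\<psi> w0 \<noteq> 0"
  shows "isomorphic_modules L \<rho> \<tau>"
proof -
  interpret \<psi>: Vector_Spaces.linear scaleC scaleC \<psi> by (rule \<psi>(1))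
  have "complex_vector.subspace {w. \<psi> w = 0}" "complex_vector.subspace (range \<psi>)"
    by (simp_all add: \<psi>.subspace_kernel \<psi>.subspace_image)
  moreover have "\<forall>x\<in>L. \<forall>w\<in>{w. \<psi> w = 0}. \<rho> x w \<in> {w. \<psi> w = 0}"
    by (auto simp: \<psi>(2) clinear_zero[OF lin])
  moreover have "\<forall>x\<in>L. \<forall>v\<in>range \<psi>. \<tau> x v \<in> range \<psi>"
    by (auto simp: \<psi>(2)[symmetric])
  ultimately have "{w. \<psi> w = 0} = {0} \<or> {w. \<psi> w = 0} = UNIV" "range \<psi> = {0} \<or> range \<psi> = UNIV"
    using irr unfolding irreducible_module_def by blast+
  then have ker: "{w. \<psi> w = 0} = {0}" and range: "range \<psi> = UNIV" using \<psi>(3) by blast+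
  have "inj \<psi>"
  proof (rule injI)
    fix x y assume "\<psi> x = \<psi> y"
    then have "x - y \<in> {w. \<psi> w = 0}" by (simp add: clinear_diff[OF \<psi>(1)])
    then show "x = y" using ker by simp
  qed
  then show ?thesis using \<psi>(1,2) range unfolding isomorphic_modules_def bij_def by blast
qed

lemma isomorphic_tensor_modules:
  fixes W1 :: "'l \<Rightarrow> 'w1::complex_vector \<Rightarrow> 'w1" and W2 :: "'l \<Rightarrow> 'w2::complex_vector \<Rightarrow> 'w2"
    and U1 :: "'l \<Rightarrow> 'u1::complex_vector \<Rightarrow> 'u1" and U2 :: "'l \<Rightarrow> 'u2::complex_vector \<Rightarrow> 'u2"
  assumes lin: "\<And>x. x \<in> L \<Longrightarrow> clinear (W1 x) \<and> clinear (W2 x) \<and> clinear (U1 x) \<and> clinear (U2 x)"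
    and iso: "isomorphic_modules L W1 W2" "isomorphic_modules L U1 U2"
  shows "isomorphic_modules L (tensor_module W1 U1) (tensor_module W2 U2)"
proof -
  obtain \<phi> where \<phi>: "clinear \<phi>" "bij \<phi>" "\<And>x w. x \<in> L \<Longrightarrow> \<phi> (W1 x w) = W2 x (\<phi> w)"
    using iso(1) by (auto simp: isomorphic_modules_def)
  obtain \<psi> where \<psi>: "clinear \<psi>" "bij \<psi>" "\<And>x u. x \<in> L \<Longrightarrow> \<psi> (U1 x u) = U2 x (\<psi> u)"
    using iso(2) by (auto simp: isomorphic_modules_def)
  note inv = clinear_inv[OF \<phi>(1,2)] clinear_inv[OF \<psi>(1,2)]
  have inverse: "\<phi> (inv \<phi> a) = a" "inv \<phi> (\<phi> b) = b" "\<psi> (inv \<psi> c) = c" "inv \<psi> (\<psi> d) = d" for a b c d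
    using \<phi>(2) \<psi>(2) by (simp_all add: bij_is_surj surj_f_inv_f bij_is_inj)
  note maps = tensor_map_pure[OF \<phi>(1) \<psi>(1)] tensor_map_pure[OF inv]
  have id: "clinear (\<lambda>z. z)" by (simp add: clinear_iff)
  have "tensor_map (inv \<phi>) (inv \<psi>) (tensor_map \<phi> \<psi> z) = z" for z
    by (rule tensor_ext[OF clinear_compose[OF clinear_tensor_map clinear_tensor_map] id])
      (simp add: maps inverse)
  moreover have "tensor_map \<phi> \<psi> (tensor_map (inv \<phi>) (inv \<psi>) z) = z" for z
    by (rule tensor_ext[OF clinear_compose[OF clinear_tensor_map clinear_tensor_map] id])
      (simp add: maps inverse)
  ultimately have "bij (tensor_map \<phi> \<psi>)"
    by (intro o_bij[of "tensor_map (inv \<phi>) (inv \<psi>)"]) (simp_all add: fun_eq_iff)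
  moreover have "tensor_map \<phi> \<psi> (tensor_module W1 U1 x z) = tensor_module W2 U2 x (tensor_map \<phi> \<psi> z)"
    if x: "x \<in> L" for x z
  proof (rule tensor_ext[of "\<lambda>z. tensor_map \<phi> \<psi> (tensor_module W1 U1 x z)"
        "\<lambda>z. tensor_module W2 U2 x (tensor_map \<phi> \<psi> z)"])
    show "clinear (\<lambda>z. tensor_map \<phi> \<psi> (tensor_module W1 U1 x z))"
      unfolding tensor_module_def by (rule clinear_compose[OF clinear_tensor_map clinear_tensor_lift])
    show "clinear (\<lambda>z. tensor_module W2 U2 x (tensor_map \<phi> \<psi> z))"
      unfolding tensor_module_def by (rule clinear_compose[OF clinear_tensor_lift clinear_tensor_map])
    show "tensor_map \<phi> \<psi> (tensor_module W1 U1 x (w \<otimes>\<^sub>c u)) = tensor_module W2 U2 x (tensor_map \<phi> \<psi> (w \<otimes>\<^sub>c u))"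
      for w u
      using lin[OF x]
      by (simp add: tensor_module_pure maps clinear_add[OF clinear_tensor_map] \<phi>(3)[OF x] \<psi>(3)[OF x])
  qed
  ultimately show ?thesis
    unfolding isomorphic_modules_def using clinear_tensor_map by blast
qed

text \<open>The hypothesis \<open>sep\<close> lets an element of \<open>L\<close> be modified so that it acts on the first tensor
  factors only, without changing its effect on finitely many vectors.\<close>

lemma tensor_modules_isomorphic_imp:
  fixes W1 :: "'l \<Rightarrow> 'w1::complex_vector \<Rightarrow> 'w1" and W2 :: "'l \<Rightarrow> 'w2::complex_vector \<Rightarrow> 'w2"
    and U1 :: "'l \<Rightarrow> 'u1::complex_vector \<Rightarrow> 'u1" and U2 :: "'l \<Rightarrow> 'u2::complex_vector \<Rightarrow> 'u2"
  assumes lin: "\<And>x. x \<in> L \<Longrightarrow> clinear (W1 x) \<and> clinear (W2 x) \<and> clinear (U1 x) \<and> clinear (U2 x)"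
    and irr: "irreducible_module L W1" "irreducible_module L W2"
      "irreducible_module L U1" "irreducible_module L U2"
    and sep: "\<And>x F1 F2. x \<in> L \<Longrightarrow> finite F1 \<Longrightarrow> finite F2 \<Longrightarrow>
      \<exists>y\<in>L. (\<forall>u. U1 y u = 0) \<and> (\<forall>u. U2 y u = 0) \<and>
        (\<forall>w\<in>F1. W1 y w = W1 x w) \<and> (\<forall>w\<in>F2. W2 y w = W2 x w)"
    and iso: "isomorphic_modules L (tensor_module W1 U1) (tensor_module W2 U2)"
  shows "isomorphic_modules L W1 W2 \<and> isomorphic_modules L U1 U2"
proof -
  obtain \<phi> where \<phi>: "clinear \<phi>" "bij \<phi>"
    "\<And>x z. x \<in> L \<Longrightarrow> \<phi> (tensor_module W1 U1 x z) = tensor_module W2 U2 x (\<phi> z)"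
    using iso by (auto simp: isomorphic_modules_def)
  have id: "clinear (\<lambda>z. z)" by (simp add: clinear_iff)
  \<comment> \<open>Choose \<open>y\<close> to agree with \<open>x\<close> at \<open>w\<close> and
    on the first components of \<open>\<phi> (w \<otimes>\<^sub>c u)\<close>, and to kill both
    second factors. Equivariance under \<open>y\<close> then reads as the claim, from which
    \<open>y\<close> has disappeared.\<close>
  have left: "\<phi> (W1 x w \<otimes>\<^sub>c u) = tensor_map (W2 x) (\<lambda>u. u) (\<phi> (w \<otimes>\<^sub>c u))" if x: "x \<in> L" for x w u
  proof -
    obtain F where F: "finite F" "\<And>f g :: 'w2 \<Rightarrow> 'w2. clinear f \<Longrightarrow> clinear g \<Longrightarrow> \<forall>w\<in>F. f w = g w \<Longrightarrow>
       tensor_map f (\<lambda>u. u) (\<phi> (w \<otimes>\<^sub>c u)) = tensor_map g (\<lambda>u. u) (\<phi> (w \<otimes>\<^sub>c u))"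
      using tensor_finite_support by metis
    obtain y where y: "y \<in> L" "\<And>u. U1 y u = 0" "\<And>u. U2 y u = 0" "W1 y w = W1 x w"
      "\<forall>w\<in>F. W2 y w = W2 x w"
      using sep[OF x, of "{w}" F] F(1) by auto
    have 0: "tensor_map (\<lambda>w. w) (U2 y) z = 0" for z
      by (rule tensor_ext[OF clinear_tensor_map, of "\<lambda>z. 0"])
        (use lin[OF y(1)] in \<open>simp_all add: tensor_map_pure[OF id] y(3) pure_tensor_simps clinear_iff\<close>)
    have "\<phi> (W1 x w \<otimes>\<^sub>c u) = \<phi> (tensor_module W1 U1 y (w \<otimes>\<^sub>c u))"
      using lin[OF y(1)] by (simp add: tensor_module_pure y(2,4) pure_tensor_simps)
    also have "\<dots> = tensor_map (W2 y) (\<lambda>u. u) (\<phi> (w \<otimes>\<^sub>c u))"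
      unfolding \<phi>(3)[OF y(1)] using lin[OF y(1)] by (simp add: tensor_module_eq 0)
    also have "\<dots> = tensor_map (W2 x) (\<lambda>u. u) (\<phi> (w \<otimes>\<^sub>c u))"
      using F(2) lin x y(1,5) by blast
    finally show ?thesis .
  qed
  \<comment> \<open>Subtract \<open>left\<close> from equivariance under \<open>x\<close>
    itself.\<close>
  have right: "\<phi> (w \<otimes>\<^sub>c U1 x u) = tensor_map (\<lambda>w. w) (U2 x) (\<phi> (w \<otimes>\<^sub>c u))" if x: "x \<in> L" for x w u
    using \<phi>(3)[OF x, of "w \<otimes>\<^sub>c u"] lin[OF x] left[OF x, of w u]
    by (simp add: tensor_module_eq clinear_add[OF \<phi>(1)] tensor_map_pure[OF _ id] tensor_map_pure[OF id])
  obtain w2 u2 where "(w2 :: 'w2) \<noteq> 0" "(u2 :: 'u2) \<noteq> 0"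
    using irr by (auto simp: irreducible_module_def)
  then have nz: "w2 \<otimes>\<^sub>c u2 \<noteq> 0" by (rule pure_tensor_nonzero)
  have "\<exists>w u. \<phi> (w \<otimes>\<^sub>c u) \<noteq> 0"
  proof (rule ccontr)
    assume "\<not> ?thesis"
    then have 0: "\<phi> (w \<otimes>\<^sub>c u) = 0" for w u by blast
    have "\<phi> z = 0" for z
      by (rule tensor_ext[OF \<phi>(1), of "\<lambda>z. 0"]) (simp_all add: 0 clinear_iff)
    moreover obtain z where "\<phi> z = w2 \<otimes>\<^sub>c u2" using bij_is_surj[OF \<phi>(2)] by (metis surjD)
    ultimately show False using nz by simp
  qed
  then obtain w u where wu: "\<phi> (w \<otimes>\<^sub>c u) \<noteq> 0" by blast
  obtain f where f: "clinear f" "slice_right f (\<phi> (w \<otimes>\<^sub>c u)) \<noteq> 0" using ex_slice_right[OF wu] by blast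
  obtain g where g: "clinear g" "slice_left g (\<phi> (w \<otimes>\<^sub>c u)) \<noteq> 0" using ex_slice_left[OF wu] by blast
  \<comment> \<open>With \<open>u\<close> fixed, contracting the second factor commutes with an
    action on the first, so \<open>left\<close> makes the sliced map a homomorphism;
    \<open>f\<close> was chosen to keep it nonzero.\<close>
  have "isomorphic_modules L W1 W2"
  proof (rule irreducible_hom_isomorphic[OF irr(1,2)])
    show "clinear (\<lambda>w. slice_right f (\<phi> (w \<otimes>\<^sub>c u)))"
      by (intro clinear_compose[OF clinear_slice(1)] clinear_compose[OF \<phi>(1)] pure_tensor_linear)
    fix x w assume x: "x \<in> L"
    have "slice_right f (tensor_map (W2 x) (\<lambda>u. u) z) = W2 x (slice_right f z)" for z
      by (rule tensor_ext[of "\<lambda>z. slice_right f (tensor_map (W2 x) (\<lambda>u. u) z)"])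
        (use lin[OF x] in \<open>simp_all add: clinear_compose clinear_slice clinear_tensor_map tensor_map_pure[OF _ id]
          slice_right_pure[OF f(1)] clinear_scale\<close>)
    then show "slice_right f (\<phi> (W1 x w \<otimes>\<^sub>c u)) = W2 x (slice_right f (\<phi> (w \<otimes>\<^sub>c u)))"
      by (simp add: left[OF x])
  qed (use lin f(2) in auto)
  moreover have "isomorphic_modules L U1 U2"
  proof (rule irreducible_hom_isomorphic[OF irr(3,4)])
    show "clinear (\<lambda>u. slice_left g (\<phi> (w \<otimes>\<^sub>c u)))"
      by (intro clinear_compose[OF clinear_slice(2)] clinear_compose[OF \<phi>(1)] pure_tensor_linear)
    fix x u assume x: "x \<in> L"
    have "slice_left g (tensor_map (\<lambda>w. w) (U2 x) z) = U2 x (slice_left g z)" for z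
      by (rule tensor_ext[of "\<lambda>z. slice_left g (tensor_map (\<lambda>w. w) (U2 x) z)"])
        (use lin[OF x] in \<open>simp_all add: clinear_compose clinear_slice clinear_tensor_map tensor_map_pure[OF id]
          slice_left_pure[OF g(1)] clinear_scale\<close>)
    then show "slice_left g (\<phi> (w \<otimes>\<^sub>c U1 x u)) = U2 x (slice_left g (\<phi> (w \<otimes>\<^sub>c u)))"
      by (simp add: right[OF x])
  qed (use lin g(2) in auto)
  ultimately show ?thesis ..
qed

theorem theorem4p4:
  fixes br :: "'g::complex_vector \<Rightarrow> 'g \<Rightarrow> 'g"
    and form :: "'g \<Rightarrow> 'g \<Rightarrow> complex"
    and \<sigma> :: "'g \<Rightarrow> 'g"
    and N :: nat
    and W1 :: "'g affine \<Rightarrow> 'w1::complex_vector \<Rightarrow> 'w1"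
    and W2 :: "'g affine \<Rightarrow> 'w2::complex_vector \<Rightarrow> 'w2"
    and U1 :: "'g affine \<Rightarrow> 'u1::complex_vector \<Rightarrow> 'u1"
    and U2 :: "'g affine \<Rightarrow> 'u2::complex_vector \<Rightarrow> 'u2"
  assumes simple: "simple_lie_algebra br"
    and finite_dim: "\<exists>B::'g set. finite B \<and> complex_vector.span B = UNIV"
    and form: "invariant_form br form" "long_roots_normalized br form"
    and automorphism: "lie_automorphism br \<sigma>" "has_order \<sigma> N"
    and W1: "category_R br form \<sigma> N W1" "irreducible_module (twisted_affine \<sigma> N) W1"
    and W2: "category_R br form \<sigma> N W2" "irreducible_module (twisted_affine \<sigma> N) W2"
    and U1: "category_E br form \<sigma> N U1" "irreducible_module (twisted_affine \<sigma> N) U1"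
    and U2: "category_E br form \<sigma> N U2" "irreducible_module (twisted_affine \<sigma> N) U2"
  shows "isomorphic_modules (twisted_affine \<sigma> N) (tensor_module W1 U1) (tensor_module W2 U2) \<longleftrightarrow>
         isomorphic_modules (twisted_affine \<sigma> N) W1 W2 \<and>
         isomorphic_modules (twisted_affine \<sigma> N) U1 U2"
proof -
  interpret twisted_setting br form \<sigma> N
    using invariant_form.form_automorphism[OF form(1) simple finite_dim form(2) automorphism(1)]
    by (intro twisted_setting.intro form(1) twisted_setting_axioms.intro automorphism)
  \<comment> \<open>A nonzero bracket serves as the nonzero element of the Lie algebra that
    \<open>separation\<close> asks for.\<close>
  obtain x y where "br x y \<noteq> 0" using simple_lie_algebra.non_abelian[OF simple] by blast
  note sep = separation[OF U1(1) U2(1) W1(1) W2(1) this]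
  have lin: "clinear (W1 X) \<and> clinear (W2 X) \<and> clinear (U1 X) \<and> clinear (U2 X)" if "X \<in> affine" for X
    using that category_R_module[OF W1(1)] category_R_module[OF W2(1)]
      category_E_module[OF U1(1)] category_E_module[OF U2(1)]
    by (simp add: lie_module.act_linear)
  show ?thesis
  proof
    assume "isomorphic_modules affine (tensor_module W1 U1) (tensor_module W2 U2)"
    from tensor_modules_isomorphic_imp[OF lin W1(2) W2(2) U1(2) U2(2) sep this]
    show "isomorphic_modules affine W1 W2 \<and> isomorphic_modules affine U1 U2" .
  next
    assume "isomorphic_modules affine W1 W2 \<and> isomorphic_modules affine U1 U2"
    then show "isomorphic_modules affine (tensor_module W1 U1) (tensor_module W2 U2)"
      using isomorphic_tensor_modules[OF lin, of affine] by (elim conjE)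
  qed
qed

end
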